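(* Let $(B,g_B)$ be an $n$-dimensional Riemannian manifold, let $\varphi>0$, $f$, $\mu$ be smooth functions on $B$ satisfying $$\Delta(f)+\mu|\mathrm{grad}(f)|^2=n\,\frac{(\mathrm{grad}(f))(\varphi)}{\varphi},$$ let $\lambda$ be a smooth function on $B$, and put $$\lambda_B:=\mathrm{scal}_B-\frac{(\mathrm{grad}(f))(\varphi)}{\varphi}.$$ Let $(F,g_F)$ be an $m$-dimensional Riemannian manifold whose scalar curvature satisfies $$\mathrm{scal}_F=\pi^*\big((\lambda-\lambda_B)\varphi^2+2m\varphi\Delta(\varphi)+m(m-1)|\mathrm{grad}(\varphi)|^2\big)\big|_F .$$ Let $g=\pi^*g_B+(\varphi\circ\pi)^2\sigma^*g_F$ be the warped product metric on $B\times_\varphi F$, and let $\xi=\mathrm{grad}(\widetilde f)$ with $\widetilde f=f\circ\pi$. Then $(g,\xi,\pi^*(\lambda),\pi^*(\mu))$ is a gradient almost quasi-Yamabe soliton on the warped product manifold $(B\times_\varphi F,g)$ if and only if $(g_B,\mathrm{grad}(f),\lambda_B,\mu)$ is a gradient almost quasi-Yamabe soliton on $(B,g_B)$.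
   Context: Here $\pi:B\times F\to B$ and $\sigma:B\times F\to F$ are the projections, and $B\times_\varphi F$ denotes $B\times F$ with the metric $g$. The condition on $\mathrm{scal}_F$ is an identity on $B\times F$: $\mathrm{scal}_F(q)=\big((\lambda-\lambda_B)\varphi^2+2m\varphi\Delta(\varphi)+m(m-1)|\mathrm{grad}(\varphi)|^2\big)(p)$ for all $(p,q)\in B\times F$. On $B$, the operators $\mathrm{grad}$, $\Delta=\mathrm{div}\circ\mathrm{grad}$, and the norm are those of $g_B$; $\mathrm{scal}_B,\mathrm{scal}_F$ are the scalar curvatures of $g_B,g_F$; $(\mathrm{grad}(f))(\varphi)=d\varphi(\mathrm{grad}(f))$. On $B\times_\varphi F$, $\mathrm{grad}(\widetilde f)$ is taken with respect to $g$. A gradient almost quasi-Yamabe soliton on a Riemannian manifold $(N,h)$ is a data $(h,\mathrm{grad}(u),\alpha,\beta)$, with $u,\alpha,\beta$ smooth functions on $N$, satisfying $$\mathrm{Hess}(u)+(\alpha-\mathrm{scal}_h)\,h+\beta\, du\otimes du=0,$$ where $\mathrm{scal}_h$ is the scalar curvature of $h$ and $\mathrm{Hess}(u)$ is the Hessian of $u$ with respect to $h$. *)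

theory Defs
  imports "HOL-Analysis.Analysis"
begin

section \<open>Smooth maps between open subsets of normed spaces\<close>

text \<open>
  Only meant for open \<open>S\<close>. In finite dimension, requiring all directional derivatives
  of the Frechet derivative to be of class \<open>C k\<close> is the usual notion of class \<open>C (k+1)\<close>.
\<close>

primrec Ck_on :: "nat \<Rightarrow> 'a::real_normed_vector set \<Rightarrow> ('a \<Rightarrow> 'b::real_normed_vector) \<Rightarrow> bool" where
  "Ck_on 0 S f \<longleftrightarrow> continuous_on S f"
| "Ck_on (Suc k) S f \<longleftrightarrow>
     (\<forall>x\<in>S. f differentiable (at x)) \<and> (\<forall>v. Ck_on k S (\<lambda>x. frechet_derivative f (at x) v))"

definition smooth_on :: "'a::real_normed_vector set \<Rightarrow> ('a \<Rightarrow> 'b::real_normed_vector) \<Rightarrow> bool" where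
  "smooth_on S f \<longleftrightarrow> (\<forall>k. Ck_on k S f)"


section \<open>Smooth manifolds\<close>

text \<open>
  The points of a manifold form a whole type \<open>'p\<close>, whose class supplies a Hausdorff second
  countable topology; the model space is a Euclidean space \<open>'e\<close>, so that the dimension is
  \<open>DIM('e)\<close>. Atlases need not be maximal.
\<close>

datatype ('p, 'e) chart = Chart (cdom: "'p set") (cmap: "'p \<Rightarrow> 'e")

definition cimg :: "('p, 'e) chart \<Rightarrow> 'e set" where
  "cimg c = cmap c ` cdom c"

definition cinv :: "('p, 'e) chart \<Rightarrow> 'e \<Rightarrow> 'p" where
  "cinv c = inv_into (cdom c) (cmap c)"

definition smooth_manifold ::
  "('p::{t2_space, second_countable_topology}, 'e::euclidean_space) chart set \<Rightarrow> bool" where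
  "smooth_manifold A \<longleftrightarrow>
     (\<forall>c\<in>A. open (cdom c) \<and> open (cimg c) \<and> homeomorphism (cdom c) (cimg c) (cmap c) (cinv c)) \<and>
     (\<Union>c\<in>A. cdom c) = UNIV \<and>
     (\<forall>c\<in>A. \<forall>d\<in>A. smooth_on (cmap c ` (cdom c \<inter> cdom d)) (cmap d \<circ> cinv c))"

text \<open>Some chart around \<open>p\<close>; everything defined below by means of it is independent of the choice.\<close>

definition chart_at :: "('p, 'e) chart set \<Rightarrow> 'p \<Rightarrow> ('p, 'e) chart" where
  "chart_at A p = (SOME c. c \<in> A \<and> p \<in> cdom c)"

definition smooth_fun_on ::
  "('p, 'e::euclidean_space) chart set \<Rightarrow> 'p set \<Rightarrow> ('p \<Rightarrow> real) \<Rightarrow> bool" where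
  "smooth_fun_on A U h \<longleftrightarrow> (\<forall>c\<in>A. smooth_on (cmap c ` (cdom c \<inter> U)) (h \<circ> cinv c))"

abbreviation smooth_fun :: "('p, 'e::euclidean_space) chart set \<Rightarrow> ('p \<Rightarrow> real) \<Rightarrow> bool" where
  "smooth_fun A \<equiv> smooth_fun_on A UNIV"

definition smooth_near ::
  "('p::topological_space, 'e::euclidean_space) chart set \<Rightarrow> 'p \<Rightarrow> ('p \<Rightarrow> real) \<Rightarrow> bool" where
  "smooth_near A p h \<longleftrightarrow> (\<exists>U. open U \<and> p \<in> U \<and> smooth_fun_on A U h)"

definition prod_atlas ::
  "('p, 'e) chart set \<Rightarrow> ('q, 'f) chart set \<Rightarrow> ('p \<times> 'q, 'e \<times> 'f) chart set" where
  "prod_atlas A B =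
     {Chart (cdom c \<times> cdom d) (map_prod (cmap c) (cmap d)) | c d. c \<in> A \<and> d \<in> B}"


section \<open>Tangent vectors\<close>

text \<open>
  A tangent vector at \<open>p\<close> is the operator of directional derivative at \<open>p\<close>, in some chart, acting
  on the real functions that are smooth near \<open>p\<close>. On all other functions it takes the value 0,
  so that two tangent vectors are equal as soon as they agree on functions smooth near \<open>p\<close>.
\<close>

type_synonym 'p tvec = "('p \<Rightarrow> real) \<Rightarrow> real"

definition coord_vec ::
  "('p::topological_space, 'e::euclidean_space) chart set \<Rightarrow> ('p, 'e) chart \<Rightarrow> 'p \<Rightarrow> 'e \<Rightarrow> 'p tvec" where
  "coord_vec A c p v =
     (\<lambda>h. if smooth_near A p h then frechet_derivative (h \<circ> cinv c) (at (cmap c p)) v else 0)"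

definition tangent_space ::
  "('p::topological_space, 'e::euclidean_space) chart set \<Rightarrow> 'p \<Rightarrow> 'p tvec set" where
  "tangent_space A p = {coord_vec A c p v | c v. c \<in> A \<and> p \<in> cdom c}"

text \<open>The components of a tangent vector are its values on the coordinate functions of the chart.\<close>

definition coords :: "('p, 'e::euclidean_space) chart \<Rightarrow> 'p tvec \<Rightarrow> 'e" where
  "coords c v = (\<Sum>i\<in>Basis. v (\<lambda>q. cmap c q \<bullet> i) *\<^sub>R i)"

definition differential :: "('p \<Rightarrow> real) \<Rightarrow> 'p tvec \<Rightarrow> real" where
  "differential h v = v h"

text \<open>The tangent map of \<open>F\<close> at \<open>p\<close>; \<open>B\<close> is an atlas of the target.\<close>

definition push_forward ::
  "('q::topological_space, 'f::euclidean_space) chart set \<Rightarrow> ('p \<Rightarrow> 'q) \<Rightarrow> 'p \<Rightarrow> 'p tvec \<Rightarrow> 'q tvec" where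
  "push_forward B F p v = (\<lambda>h. if smooth_near B (F p) h then v (h \<circ> F) else 0)"


section \<open>Riemannian metrics\<close>

text \<open>Covariant 2-tensor fields; only their values on tangent vectors at the given point matter.\<close>

type_synonym 'p bform = "'p \<Rightarrow> 'p tvec \<Rightarrow> 'p tvec \<Rightarrow> real"

definition pull_back ::
  "('q::topological_space, 'f::euclidean_space) chart set \<Rightarrow> ('p \<Rightarrow> 'q) \<Rightarrow> 'q bform \<Rightarrow> 'p bform" where
  "pull_back B F b = (\<lambda>p v w. b (F p) (push_forward B F p v) (push_forward B F p w))"

definition local_form ::
  "('p::topological_space, 'e::euclidean_space) chart set \<Rightarrow> 'p bform \<Rightarrow> ('p, 'e) chart \<Rightarrow>
     'e \<Rightarrow> 'e \<Rightarrow> 'e \<Rightarrow> real" where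
  "local_form A g c x v w = g (cinv c x) (coord_vec A c (cinv c x) v) (coord_vec A c (cinv c x) w)"

definition riemannian_metric ::
  "('p::topological_space, 'e::euclidean_space) chart set \<Rightarrow> 'p bform \<Rightarrow> bool" where
  "riemannian_metric A g \<longleftrightarrow>
     (\<forall>c\<in>A. let G = local_form A g c in
        (\<forall>x\<in>cimg c. bilinear (G x) \<and> (\<forall>v w. G x v w = G x w v) \<and> (\<forall>v. v \<noteq> 0 \<longrightarrow> G x v v > 0)) \<and>
        (\<forall>v w. smooth_on (cimg c) (\<lambda>x. G x v w)))"

definition riemannian_manifold ::
  "('p::{t2_space, second_countable_topology}, 'e::euclidean_space) chart set \<Rightarrow> 'p bform \<Rightarrow> bool" where
  "riemannian_manifold A g \<longleftrightarrow> smooth_manifold A \<and> riemannian_metric A g"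

definition gnorm :: "'p bform \<Rightarrow> 'p \<Rightarrow> 'p tvec \<Rightarrow> real" where
  "gnorm g p v = sqrt (g p v v)"

definition grad ::
  "('p::topological_space, 'e::euclidean_space) chart set \<Rightarrow> 'p bform \<Rightarrow> ('p \<Rightarrow> real) \<Rightarrow> 'p \<Rightarrow> 'p tvec" where
  "grad A g u p =
     (THE v. v \<in> tangent_space A p \<and> (\<forall>w\<in>tangent_space A p. g p v w = differential u w))"

definition warped_metric ::
  "('p::topological_space, 'e::euclidean_space) chart set \<Rightarrow> ('q::topological_space, 'f::euclidean_space) chart set \<Rightarrow>
     ('p \<Rightarrow> real) \<Rightarrow> 'p bform \<Rightarrow> 'q bform \<Rightarrow> ('p \<times> 'q) bform" where
  "warped_metric A B \<phi> gB gF = (\<lambda>z v w.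
     pull_back A fst gB z v w + ((\<phi> \<circ> fst) z)\<^sup>2 * pull_back B snd gF z v w)"


section \<open>Levi-Civita connection and curvature in a chart\<close>

text \<open>
  Here \<open>G\<close> is a metric on an open subset of the model space and \<open>x\<close> a point of it. The function
  \<open>sharp (G x)\<close> turns a linear form into the vector representing it.
\<close>

definition sharp :: "('e \<Rightarrow> 'e \<Rightarrow> real) \<Rightarrow> ('e \<Rightarrow> real) \<Rightarrow> 'e" where
  "sharp b \<alpha> = (THE v. \<forall>w. b v w = \<alpha> w)"

definition endo_trace :: "('e::euclidean_space \<Rightarrow> 'e) \<Rightarrow> real" where
  "endo_trace L = (\<Sum>i\<in>Basis. L i \<bullet> i)"

text \<open>
  \<open>christoffel G x v w\<close> is the covariant derivative at \<open>x\<close> of the constant vector field \<open>w\<close>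
  in direction \<open>v\<close>, as given by the Koszul formula; in a basis it is
  \<open>\<Gamma>\<^sup>k\<^sub>i\<^sub>j = 1/2 g\<^sup>k\<^sup>l (\<partial>\<^sub>i g\<^sub>j\<^sub>l + \<partial>\<^sub>j g\<^sub>i\<^sub>l - \<partial>\<^sub>l g\<^sub>i\<^sub>j)\<close>.
\<close>

definition christoffel ::
  "('e::euclidean_space \<Rightarrow> 'e \<Rightarrow> 'e \<Rightarrow> real) \<Rightarrow> 'e \<Rightarrow> 'e \<Rightarrow> 'e \<Rightarrow> 'e" where
  "christoffel G x v w = sharp (G x) (\<lambda>z.
     (frechet_derivative (\<lambda>y. G y w z) (at x) v
      + frechet_derivative (\<lambda>y. G y v z) (at x) w
      - frechet_derivative (\<lambda>y. G y v w) (at x) z) / 2)"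

definition covariant_deriv ::
  "('e::euclidean_space \<Rightarrow> 'e \<Rightarrow> 'e \<Rightarrow> real) \<Rightarrow> ('e \<Rightarrow> 'e) \<Rightarrow> 'e \<Rightarrow> 'e \<Rightarrow> 'e" where
  "covariant_deriv G X x v = frechet_derivative X (at x) v + christoffel G x v (X x)"

text \<open>
  \<open>R(u,v)w = \<nabla>\<^sub>u \<nabla>\<^sub>v w - \<nabla>\<^sub>v \<nabla>\<^sub>u w\<close> for constant vector fields \<open>u\<close>, \<open>v\<close>, \<open>w\<close>, whose Lie brackets vanish.
\<close>

definition riemann ::
  "('e::euclidean_space \<Rightarrow> 'e \<Rightarrow> 'e \<Rightarrow> real) \<Rightarrow> 'e \<Rightarrow> 'e \<Rightarrow> 'e \<Rightarrow> 'e \<Rightarrow> 'e" where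
  "riemann G x u v w =
     covariant_deriv G (\<lambda>y. christoffel G y v w) x u - covariant_deriv G (\<lambda>y. christoffel G y u w) x v"

definition ricci ::
  "('e::euclidean_space \<Rightarrow> 'e \<Rightarrow> 'e \<Rightarrow> real) \<Rightarrow> 'e \<Rightarrow> 'e \<Rightarrow> 'e \<Rightarrow> real" where
  "ricci G x v w = endo_trace (\<lambda>u. riemann G x u v w)"

definition scalar_curvature :: "('e::euclidean_space \<Rightarrow> 'e \<Rightarrow> 'e \<Rightarrow> real) \<Rightarrow> 'e \<Rightarrow> real" where
  "scalar_curvature G x = endo_trace (\<lambda>v. sharp (G x) (ricci G x v))"


section \<open>Scalar curvature, divergence, Laplacian and Hessian on a manifold\<close>

definition scal ::
  "('p::topological_space, 'e::euclidean_space) chart set \<Rightarrow> 'p bform \<Rightarrow> 'p \<Rightarrow> real" where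
  "scal A g p = (let c = chart_at A p in scalar_curvature (local_form A g c) (cmap c p))"

definition divergence ::
  "('p::topological_space, 'e::euclidean_space) chart set \<Rightarrow> 'p bform \<Rightarrow> ('p \<Rightarrow> 'p tvec) \<Rightarrow> 'p \<Rightarrow> real" where
  "divergence A g X p = (let c = chart_at A p in
     endo_trace (covariant_deriv (local_form A g c) (\<lambda>x. coords c (X (cinv c x))) (cmap c p)))"

definition laplacian ::
  "('p::topological_space, 'e::euclidean_space) chart set \<Rightarrow> 'p bform \<Rightarrow> ('p \<Rightarrow> real) \<Rightarrow> 'p \<Rightarrow> real" where
  "laplacian A g u = divergence A g (grad A g u)"

text \<open>
  The covariant derivative of the 1-form \<open>du\<close>: for the constant extensions of \<open>v\<close> and \<open>w\<close> in the
  chart, \<open>Hess(u)(v,w) = v(w(u)) - du(\<nabla>\<^sub>v w)\<close>.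
\<close>

definition hess ::
  "('p::topological_space, 'e::euclidean_space) chart set \<Rightarrow> 'p bform \<Rightarrow> ('p \<Rightarrow> real) \<Rightarrow> 'p bform" where
  "hess A g u p v w = (let c = chart_at A p; x = cmap c p; U = u \<circ> cinv c; a = coords c v; b = coords c w in
     frechet_derivative (\<lambda>y. frechet_derivative U (at y) b) (at x) a
     - frechet_derivative U (at x) (christoffel (local_form A g c) x a b))"


section \<open>Gradient almost quasi-Yamabe solitons\<close>

text \<open>\<open>(h, \<xi>, \<alpha>, \<beta>)\<close> with \<open>\<xi> = grad(u)\<close>, on the manifold with atlas \<open>A\<close>.\<close>

definition gradient_almost_quasi_Yamabe_soliton ::
  "('p::{t2_space, second_countable_topology}, 'e::euclidean_space) chart set \<Rightarrow>
     'p bform \<Rightarrow> ('p \<Rightarrow> 'p tvec) \<Rightarrow> ('p \<Rightarrow> real) \<Rightarrow> ('p \<Rightarrow> real) \<Rightarrow> bool" where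
  "gradient_almost_quasi_Yamabe_soliton A h \<xi> \<alpha> \<beta> \<longleftrightarrow>
     riemannian_manifold A h \<and> smooth_fun A \<alpha> \<and> smooth_fun A \<beta> \<and>
     (\<exists>u. smooth_fun A u \<and> \<xi> = grad A h u \<and>
        (\<forall>p. \<forall>v\<in>tangent_space A p. \<forall>w\<in>tangent_space A p.
           hess A h u p v w + (\<alpha> p - scal A h p) * h p v w
           + \<beta> p * (differential u v * differential u w) = 0))"

end

theory Submission
  imports Defs
begin

text \<open>
  Write \<open>m\<close> for the dimension of the fibre and \<open>\<langle>_, _\<rangle>\<close> for the metric of the base.
  The theorem rests on two formulas for the warped product:
    \<^item> \<open>Hess(f \<circ> fst)(v, w) = Hess(f)(v\<^sub>B, w\<^sub>B) + \<phi> g\<^sub>F(v\<^sub>F, w\<^sub>F) \<langle>grad f, grad \<phi>\<rangle>\<close>,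
    \<^item> \<open>scal = scal\<^sub>B + (scal\<^sub>F - 2 m \<phi> \<Delta>\<phi> - m (m - 1) |grad \<phi>|\<^sup>2) / \<phi>\<^sup>2\<close>.

  By the second one, the hypothesis on the scalar curvature of the fibre says that \<open>\<lambda> - scal\<close> equals
  \<open>\<lambda>\<^sub>B - scal\<^sub>B\<close>, which is \<open>- \<langle>grad f, grad \<phi>\<rangle> / \<phi>\<close> by the definition of \<open>\<lambda>\<^sub>B\<close>. Hence in the soliton equation on
  the warped product the vertical part of \<open>(\<lambda> - scal) g\<close>, namely \<open>- \<phi> \<langle>grad f, grad \<phi>\<rangle> g\<^sub>F\<close>, cancels the vertical part of the
  Hessian; the mixed parts vanish; and the horizontal part is the soliton equation on the base
  (lemma \<open>soliton_equation_warped\<close>).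

  Two points remain. A soliton is given by a gradient field, while its potential is existentially quantified; but
  functions with equal gradients have equal differentials and Hessians, so one may always
  take \<open>f\<close> and \<open>f \<circ> fst\<close> (\<open>soliton_iff\<close>). And \<open>\<lambda>\<^sub>B\<close> has to be smooth for the data on the base: this follows by
  solving the hypothesis on the fibre, at a fixed point of the fibre, for \<open>\<lambda>\<^sub>B\<close>, since \<open>\<Delta>\<phi>\<close> and
  \<open>|grad \<phi>|\<^sup>2\<close> are smooth.

  The two formulas are computed in coordinates, from the Christoffel symbols of the warped product
  (\<open>christoffel_warped\<close>, \<open>riemann_warped\<close>, \<open>scalar_curvature_warped\<close>, \<open>local_hess_warped\<close>). Since curvature, Hessian and
  Laplacian on a manifold are defined by means of an arbitrarily chosen chart, and the chart chosen at a point of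
  the product need not be the product of the charts chosen at its two projections, one also
  needs that they do not depend on the chart. This is proved as invariance under local isometries
  of metrics on open sets (\<open>riemann_transform\<close>, \<open>local_hess_transform\<close>), where the correction terms due to the
  second and third derivatives of the isometry are symmetric and drop out. The analytic input is
  the symmetry of second derivatives and the smoothness of \<open>sharp\<close>, that is, of the inverse of a metric (\<open>Ck_on_sharp\<close>).
\<close>

section \<open>Calculus of smooth maps\<close>

abbreviation D :: "('a::real_normed_vector \<Rightarrow> 'b::real_normed_vector) \<Rightarrow> 'a \<Rightarrow> 'a \<Rightarrow> 'b" where
  "D f x \<equiv> frechet_derivative f (at x)"

lemma D_eqI: "(f has_derivative f') (at x) \<Longrightarrow> D f x = f'"
  by (metis frechet_derivative_at)

lemma D_cong:
  assumes "open S" "x \<in> S" "\<And>y. y \<in> S \<Longrightarrow> f y = g y"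
  shows "D f x = D g x"
proof -
  have "(f has_derivative F) (at x) \<longleftrightarrow> (g has_derivative F) (at x)" for F
    using has_derivative_transform_within_open[OF _ assms(1,2), of f F UNIV g]
      has_derivative_transform_within_open[OF _ assms(1,2), of g F UNIV f] assms(3)
    by auto
  then show ?thesis unfolding frechet_derivative_def by simp
qed

lemma differentiable_cong:
  assumes "open S" "x \<in> S" "\<And>y. y \<in> S \<Longrightarrow> f y = g y" "f differentiable (at x)"
  shows "g differentiable (at x)"
  using assms has_derivative_transform_within_open[OF _ assms(1,2), of f _ UNIV g]
  unfolding differentiable_def by blast

lemma Ck_on_cong:
  assumes "open S" "\<And>x. x \<in> S \<Longrightarrow> f x = g x"
  shows "Ck_on k S f \<longleftrightarrow> Ck_on k S g"
  using assms(2)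
proof (induction k arbitrary: f g)
  case 0
  then show ?case by (auto intro: continuous_on_eq)
next
  case (Suc k)
  have "f differentiable (at x) \<longleftrightarrow> g differentiable (at x)" if "x \<in> S" for x
    using differentiable_cong[OF assms(1) that, of f g] differentiable_cong[OF assms(1) that, of g f] Suc.prems by auto
  moreover have "Ck_on k S (\<lambda>x. D f x v) \<longleftrightarrow> Ck_on k S (\<lambda>x. D g x v)" for v
    using D_cong[OF assms(1), of _ f g] Suc.prems by (intro Suc.IH) simp
  ultimately show ?case by auto
qed

text \<open>
  Lets every closure property below be proved by exhibiting a formula for the derivative and
  appealing to the induction hypothesis for that formula.
\<close>

lemma Ck_on_SucI:
  assumes "open S" "\<And>x. x \<in> S \<Longrightarrow> (f has_derivative f' x) (at x)" "\<And>v. Ck_on k S (\<lambda>x. f' x v)"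
  shows "Ck_on (Suc k) S f"
proof -
  have "Ck_on k S (\<lambda>x. D f x v)" for v
    using Ck_on_cong[OF assms(1), of "\<lambda>x. D f x v" "\<lambda>x. f' x v"] assms(2,3) D_eqI by metis
  then show ?thesis using assms(2) by (auto simp: differentiable_def)
qed

lemma Ck_on_SucD:
  assumes "Ck_on (Suc k) S f"
  shows "\<And>x. x \<in> S \<Longrightarrow> (f has_derivative D f x) (at x)" "\<And>v. Ck_on k S (\<lambda>x. D f x v)"
  using assms by (auto simp: frechet_derivative_works[symmetric])

lemma Ck_on_pred: "Ck_on (Suc k) S f \<Longrightarrow> Ck_on k S f"
proof (induction k arbitrary: f)
  case 0
  then show ?case
    by (auto intro!: continuous_at_imp_continuous_on differentiable_imp_continuous_within)
next
  case (Suc k)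
  then show ?case by (auto simp del: Ck_on.simps(2) simp: Ck_on.simps(2)[of "Suc k"] Ck_on.simps(2)[of k S f])
qed

lemma Ck_on_subset: "Ck_on k S f \<Longrightarrow> T \<subseteq> S \<Longrightarrow> Ck_on k T f"
  by (induction k arbitrary: f) (auto intro: continuous_on_subset)

lemma Ck_on_const: "open S \<Longrightarrow> Ck_on k S (\<lambda>x. c)"
  by (induction k arbitrary: c) (auto intro!: continuous_on_const)

lemma Ck_on_bounded_linear:
  assumes "bounded_linear L" "open S" "Ck_on k S f"
  shows "Ck_on k S (\<lambda>x. L (f x))"
  using assms(3)
proof (induction k arbitrary: f)
  case 0
  then show ?case using bounded_linear.continuous_on[OF assms(1)] by auto
next
  case (Suc k)
  show ?case
    by (rule Ck_on_SucI[OF assms(2), where f' = "\<lambda>x v. L (D f x v)"])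
       (auto intro: bounded_linear.has_derivative[OF assms(1)] Ck_on_SucD(1)[OF Suc.prems]
           Suc.IH Ck_on_SucD(2)[OF Suc.prems])
qed

lemma Ck_on_add:
  assumes "open S" "Ck_on k S f" "Ck_on k S g"
  shows "Ck_on k S (\<lambda>x. f x + g x)"
  using assms(2,3)
proof (induction k arbitrary: f g)
  case 0
  then show ?case by (auto intro: continuous_on_add)
next
  case (Suc k)
  show ?case
    by (rule Ck_on_SucI[OF assms(1), where f' = "\<lambda>x v. D f x v + D g x v"])
       (auto intro!: has_derivative_add Suc.IH Ck_on_SucD[OF Suc.prems(1)] Ck_on_SucD[OF Suc.prems(2)])
qed

lemma Ck_on_sum:
  assumes "open S" "\<And>i. i \<in> I \<Longrightarrow> Ck_on k S (f i)"
  shows "Ck_on k S (\<lambda>x. \<Sum>i\<in>I. f i x)"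
  using assms by (induction I rule: infinite_finite_induct) (auto intro: Ck_on_add Ck_on_const)

lemma Ck_on_bilinear:
  assumes "bounded_bilinear P" "open S" "Ck_on k S f" "Ck_on k S g"
  shows "Ck_on k S (\<lambda>x. P (f x) (g x))"
  using assms(3,4)
proof (induction k arbitrary: f g)
  case 0
  then show ?case using bounded_bilinear.continuous_on[OF assms(1)] by auto
next
  case (Suc k)
  show ?case
    by (rule Ck_on_SucI[OF assms(2), where f' = "\<lambda>x v. P (f x) (D g x v) + P (D f x v) (g x)"])
       (auto intro!: bounded_bilinear.FDERIV[OF assms(1)] Ck_on_add Suc.IH assms(2) Ck_on_pred[OF Suc.prems(1)]
          Ck_on_pred[OF Suc.prems(2)] Ck_on_SucD[OF Suc.prems(1)] Ck_on_SucD[OF Suc.prems(2)])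
qed

lemma Ck_on_inverse:
  fixes f :: "'a::real_normed_vector \<Rightarrow> real"
  assumes "open S" "Ck_on k S f" "\<And>x. x \<in> S \<Longrightarrow> f x \<noteq> 0"
  shows "Ck_on k S (\<lambda>x. inverse (f x))"
  using assms(2)
proof (induction k)
  case 0
  then show ?case using assms by (auto intro: continuous_on_inverse)
next
  case (Suc k)
  have "Ck_on k S (\<lambda>x. - (inverse (f x) * D f x v * inverse (f x)))" for v
    by (intro Ck_on_bilinear[OF bounded_bilinear_mult] assms(1) Ck_on_bounded_linear[OF bounded_linear_minus[OF bounded_linear_ident]]
        Suc.IH Ck_on_pred[OF Suc.prems] Ck_on_SucD(2)[OF Suc.prems])
  then show ?case
    by (intro Ck_on_SucI[OF assms(1), where f' = "\<lambda>x v. - (inverse (f x) * D f x v * inverse (f x))"]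
        Deriv.has_derivative_inverse assms Ck_on_SucD(1)[OF Suc.prems]) auto
qed

lemma linear_expand:
  fixes L :: "'a::euclidean_space \<Rightarrow> 'b::real_vector"
  assumes "linear L"
  shows "L v = (\<Sum>j\<in>Basis. (v \<bullet> j) *\<^sub>R L j)"
proof -
  have "L v = L (\<Sum>j\<in>Basis. (v \<bullet> j) *\<^sub>R j)" by (simp add: euclidean_representation)
  also have "\<dots> = (\<Sum>j\<in>Basis. (v \<bullet> j) *\<^sub>R L j)"
    by (simp add: linear_sum[OF assms] linear_scale[OF assms])
  finally show ?thesis .
qed

text \<open>
  In the chain rule the vector \<open>D f x v\<close> is expanded in a basis, because the induction hypothesis
  speaks of \<open>D g\<close> in a fixed direction only.
\<close>

lemma Ck_on_compose:
  fixes g :: "'b::euclidean_space \<Rightarrow> 'c::real_normed_vector"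
  assumes "open S" "Ck_on k T g" "Ck_on k S f" "\<And>x. x \<in> S \<Longrightarrow> f x \<in> T"
  shows "Ck_on k S (\<lambda>x. g (f x))"
  using assms(2,3)
proof (induction k arbitrary: g)
  case 0
  then show ?case using assms(4) continuous_on_compose2[of T g S f] by auto
next
  case (Suc k)
  have *: "D g (f x) (D f x v) = (\<Sum>j\<in>Basis. (D f x v \<bullet> j) *\<^sub>R D g (f x) j)" if "x \<in> S" for x v
    using linear_expand[OF has_derivative_linear[OF Ck_on_SucD(1)[OF Suc.prems(1) assms(4)[OF that]]]] .
  have "Ck_on k S (\<lambda>x. \<Sum>j\<in>Basis. (D f x v \<bullet> j) *\<^sub>R D g (f x) j)" for v
    by (intro Ck_on_sum Ck_on_bilinear[OF bounded_bilinear_scaleR] assms(1)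
        Ck_on_bounded_linear[OF bounded_linear_inner_left] Suc.IH
        Ck_on_SucD(2)[OF Suc.prems(1)] Ck_on_SucD(2)[OF Suc.prems(2)] Ck_on_pred[OF Suc.prems(2)])
  then have "Ck_on k S (\<lambda>x. D g (f x) (D f x v))" for v
    using Ck_on_cong[OF assms(1), of "\<lambda>x. D g (f x) (D f x v)"] * by force
  then show ?case
    by (intro Ck_on_SucI[OF assms(1), where f' = "\<lambda>x v. D g (f x) (D f x v)"])
       (auto intro!: has_derivative_compose[where g = g] Ck_on_SucD(1)[OF Suc.prems(1)] Ck_on_SucD(1)[OF Suc.prems(2)] assms(4))
qed

lemma Ck_on_linear:
  assumes "bounded_linear L" "open S" shows "Ck_on k S L"
proof (cases k)
  case 0
  then show ?thesis using bounded_linear.continuous_on[OF assms(1) continuous_on_id] by simp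
next
  case (Suc k)
  then show ?thesis
    by (auto intro!: Ck_on_SucI[OF assms(2), where f' = "\<lambda>x v. L v"] bounded_linear_imp_has_derivative assms Ck_on_const simp del: Ck_on.simps)
qed

lemma Ck_on_Pair:
  assumes "open S" "Ck_on k S f" "Ck_on k S g"
  shows "Ck_on k S (\<lambda>x. (f x, g x))"
proof -
  have "Ck_on k S (\<lambda>x. (f x, 0) + (0, g x))"
    by (intro Ck_on_add Ck_on_bounded_linear[where L = "\<lambda>x. (x, 0)"]
        Ck_on_bounded_linear[where L = "\<lambda>x. (0, x)"] assms bounded_linear_Pair bounded_linear_zero bounded_linear_ident)
  then show ?thesis by simp
qed

lemma smooth_on_cong:
  "open S \<Longrightarrow> (\<And>x. x \<in> S \<Longrightarrow> f x = g x) \<Longrightarrow> smooth_on S f \<longleftrightarrow> smooth_on S g"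
  unfolding smooth_on_def using Ck_on_cong by metis

lemma
  assumes "smooth_on S f"
  shows smooth_on_has_derivative: "x \<in> S \<Longrightarrow> (f has_derivative D f x) (at x)"
    and smooth_on_D: "smooth_on S (\<lambda>x. D f x v)"
  using assms Ck_on_SucD unfolding smooth_on_def by blast+

lemma smooth_on_subset: "smooth_on S f \<Longrightarrow> T \<subseteq> S \<Longrightarrow> smooth_on T f"
  unfolding smooth_on_def using Ck_on_subset by blast

lemma smooth_on_linear: "bounded_linear L \<Longrightarrow> open S \<Longrightarrow> smooth_on S L"
  unfolding smooth_on_def using Ck_on_linear by blast

lemma smooth_on_const: "open S \<Longrightarrow> smooth_on S (\<lambda>x. c)"
  unfolding smooth_on_def using Ck_on_const by blast

lemma smooth_on_add: "open S \<Longrightarrow> smooth_on S f \<Longrightarrow> smooth_on S g \<Longrightarrow> smooth_on S (\<lambda>x. f x + g x)"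
  unfolding smooth_on_def using Ck_on_add by blast

lemma smooth_on_bounded_linear:
  "bounded_linear L \<Longrightarrow> open S \<Longrightarrow> smooth_on S f \<Longrightarrow> smooth_on S (\<lambda>x. L (f x))"
  unfolding smooth_on_def using Ck_on_bounded_linear by blast

lemma smooth_on_diff:
  "open S \<Longrightarrow> smooth_on S f \<Longrightarrow> smooth_on S g \<Longrightarrow> smooth_on S (\<lambda>x. f x - g x)"
  using smooth_on_add[of S f "\<lambda>x. - g x"] smooth_on_bounded_linear[OF bounded_linear_minus[OF bounded_linear_ident], of S g]
  by simp

lemma smooth_on_sum: "open S \<Longrightarrow> (\<And>i. i \<in> I \<Longrightarrow> smooth_on S (f i)) \<Longrightarrow> smooth_on S (\<lambda>x. \<Sum>i\<in>I. f i x)"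
  unfolding smooth_on_def using Ck_on_sum[of S I _ f] by blast

lemma smooth_on_bilinear:
  "bounded_bilinear P \<Longrightarrow> open S \<Longrightarrow> smooth_on S f \<Longrightarrow> smooth_on S g \<Longrightarrow> smooth_on S (\<lambda>x. P (f x) (g x))"
  unfolding smooth_on_def using Ck_on_bilinear by blast

lemmas smooth_on_mult = smooth_on_bilinear[OF bounded_bilinear_mult]
lemmas smooth_on_inner_left = smooth_on_bounded_linear[OF bounded_linear_inner_left]

lemma smooth_on_divide:
  fixes f g :: "'a::real_normed_vector \<Rightarrow> real"
  assumes "open S" "smooth_on S f" "smooth_on S g" "\<And>x. x \<in> S \<Longrightarrow> g x \<noteq> 0"
  shows "smooth_on S (\<lambda>x. f x / g x)"
  using assms Ck_on_bilinear[OF bounded_bilinear_mult assms(1) _ Ck_on_inverse, of _ f g]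
  unfolding smooth_on_def divide_inverse by blast

lemma smooth_on_compose:
  fixes g :: "'b::euclidean_space \<Rightarrow> 'c::real_normed_vector"
  shows "open S \<Longrightarrow> smooth_on T g \<Longrightarrow> smooth_on S f \<Longrightarrow> (\<And>x. x \<in> S \<Longrightarrow> f x \<in> T) \<Longrightarrow> smooth_on S (\<lambda>x. g (f x))"
  unfolding smooth_on_def using Ck_on_compose by blast

lemma smooth_on_Pair: "open S \<Longrightarrow> smooth_on S f \<Longrightarrow> smooth_on S g \<Longrightarrow> smooth_on S (\<lambda>x. (f x, g x))"
  unfolding smooth_on_def using Ck_on_Pair by blast

lemma smooth_on_continuous: "smooth_on S f \<Longrightarrow> continuous_on S f"
  unfolding smooth_on_def using Ck_on.simps(1) by blast

section \<open>Symmetry of second derivatives\<close>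

lemma DERIV_along_line:
  fixes f :: "'a::real_normed_vector \<Rightarrow> real"
  assumes "(f has_derivative f') (at (a + s *\<^sub>R u))"
  shows "((\<lambda>s. f (a + s *\<^sub>R u)) has_real_derivative f' u) (at s)"
proof -
  have "((\<lambda>s. a + s *\<^sub>R u) has_derivative (\<lambda>h. h *\<^sub>R u)) (at s)"
    by (auto intro!: derivative_eq_intros)
  from has_derivative_compose[OF this assms]
  have "((\<lambda>s. f (a + s *\<^sub>R u)) has_derivative (\<lambda>h. f' (h *\<^sub>R u))) (at s)" .
  moreover have "f' (h *\<^sub>R u) = f' u * h" for h
    using linear_scale[OF has_derivative_linear[OF assms]] by simp
  ultimately show ?thesis by (simp add: has_field_derivative_def)
qed

text \<open>
  The second difference of \<open>f\<close> over the parallelogram spanned by \<open>t *\<^sub>R u\<close> and \<open>t *\<^sub>R v\<close> is symmetric in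
  \<open>u\<close> and \<open>v\<close>; two applications of the mean value theorem turn it into a mixed second derivative at
  a nearby point.
\<close>

lemma second_difference_mean_value:
  fixes f :: "'a::real_normed_vector \<Rightarrow> real"
  assumes f: "smooth_on S f" and t: "0 < t"
    and S: "\<And>a b. 0 \<le> a \<Longrightarrow> a \<le> t \<Longrightarrow> 0 \<le> b \<Longrightarrow> b \<le> t \<Longrightarrow> x + a *\<^sub>R u + b *\<^sub>R v \<in> S"
  obtains a b where "0 < a" "a < t" "0 < b" "b < t"
    "f (x + t *\<^sub>R u + t *\<^sub>R v) - f (x + t *\<^sub>R u) - (f (x + t *\<^sub>R v) - f x) =
      t * (t * D (\<lambda>z. D f z u) (x + a *\<^sub>R u + b *\<^sub>R v) v)"
proof -
  have d: "((\<lambda>s. f (x + t *\<^sub>R v + s *\<^sub>R u) - f (x + s *\<^sub>R u)) has_real_derivative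
      (D f (x + t *\<^sub>R v + s *\<^sub>R u) u - D f (x + s *\<^sub>R u) u)) (at s)" if "0 \<le> s" "s \<le> t" for s
    using S[of s t] S[of s 0] that t
    by (intro DERIV_diff DERIV_along_line smooth_on_has_derivative[OF f]) (auto simp: algebra_simps)
  obtain a where a: "0 < a" "a < t"
    "f (x + t *\<^sub>R v + t *\<^sub>R u) - f (x + t *\<^sub>R u) - (f (x + t *\<^sub>R v + 0 *\<^sub>R u) - f (x + 0 *\<^sub>R u)) =
     (t - 0) * (D f (x + t *\<^sub>R v + a *\<^sub>R u) u - D f (x + a *\<^sub>R u) u)"
    using MVT2[OF t d] by metis
  have d2: "((\<lambda>s. D f (x + a *\<^sub>R u + s *\<^sub>R v) u) has_real_derivative
      (D (\<lambda>z. D f z u) (x + a *\<^sub>R u + s *\<^sub>R v) v)) (at s)" if "0 \<le> s" "s \<le> t" for s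
    using S[of a s] that a
    by (intro DERIV_along_line smooth_on_has_derivative[OF smooth_on_D[OF f]]) auto
  obtain b where b: "0 < b" "b < t"
    "D f (x + a *\<^sub>R u + t *\<^sub>R v) u - D f (x + a *\<^sub>R u + 0 *\<^sub>R v) u
      = (t - 0) * D (\<lambda>z. D f z u) (x + a *\<^sub>R u + b *\<^sub>R v) v"
    using MVT2[OF t d2] by metis
  show thesis
    using that[OF a(1,2) b(1,2)] a(3) b(3) by (simp add: algebra_simps)
qed

text \<open>
  Both mixed derivatives at points close to \<open>x\<close> equal the same second difference divided by the square
  of \<open>t\<close>, so by continuity they agree at \<open>x\<close>.
\<close>

lemma second_derivative_symmetric_real:
  fixes f :: "'a::real_normed_vector \<Rightarrow> real"
  assumes S: "open S" "x \<in> S" and f: "smooth_on S f"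
  shows "D (\<lambda>z. D f z u) x v = D (\<lambda>z. D f z v) x u"
proof (rule ccontr)
  let ?F = "\<lambda>u v y. D (\<lambda>z. D f z u) y v"
  assume "?F u v x \<noteq> ?F v u x"
  define \<epsilon> where "\<epsilon> = dist (?F u v x) (?F v u x) / 2"
  have \<epsilon>: "\<epsilon> > 0" using \<open>?F u v x \<noteq> ?F v u x\<close> by (simp add: \<epsilon>_def)
  have c: "continuous_on S (?F u v)" for u v
    by (intro smooth_on_continuous smooth_on_D f)
  have near: "\<exists>d>0. \<forall>y\<in>S. dist y x < d \<longrightarrow> dist (?F u v y) (?F u v x) < \<epsilon>" for u v
    using c[of u v] S(2) \<epsilon> unfolding continuous_on_iff by blast
  obtain d1 where d1: "d1 > 0" "\<And>y. y \<in> S \<Longrightarrow> dist y x < d1 \<Longrightarrow> dist (?F u v y) (?F u v x) < \<epsilon>"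
    using near[of u v] by blast
  obtain d2 where d2: "d2 > 0" "\<And>y. y \<in> S \<Longrightarrow> dist y x < d2 \<Longrightarrow> dist (?F v u y) (?F v u x) < \<epsilon>"
    using near[of v u] by blast
  obtain e where e: "e > 0" "ball x e \<subseteq> S" using S openE by blast
  define r where "r = min e (min d1 d2)"
  \<comment> \<open>so small that the parallelogram stays within distance \<open>r\<close> of \<open>x\<close>\<close>
  define t where "t = r / (2 * (norm u + norm v + 1))"
  have r: "r > 0" using e d1 d2 by (simp add: r_def)
  have n: "norm u + norm v + 1 > 0" by (smt (verit) norm_ge_zero)
  have t: "t > 0" using r n by (simp add: t_def)
  have close: "dist (x + a *\<^sub>R u + b *\<^sub>R v) x < r" if "0 \<le> a" "a \<le> t" "0 \<le> b" "b \<le> t" for a b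
  proof -
    have "dist (x + a *\<^sub>R u + b *\<^sub>R v) x = norm (a *\<^sub>R u + b *\<^sub>R v)" by (simp add: dist_norm)
    also have "\<dots> \<le> a * norm u + b * norm v"
      using norm_triangle_ineq[of "a *\<^sub>R u" "b *\<^sub>R v"] that by simp
    also have "\<dots> \<le> t * norm u + t * norm v"
      using that by (intro add_mono mult_right_mono) auto
    also have "\<dots> < t * (2 * (norm u + norm v + 1))"
      using mult_strict_left_mono[OF _ t, of "norm u + norm v" "2 * (norm u + norm v + 1)"] n
      by (simp add: distrib_left)
    also have "\<dots> = r" using n by (simp add: t_def)
    finally show ?thesis .
  qed
  have inS: "x + a *\<^sub>R u + b *\<^sub>R v \<in> S" if "0 \<le> a" "a \<le> t" "0 \<le> b" "b \<le> t" for a b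
    using close[OF that] e(2) by (auto simp: r_def dist_commute)
  obtain a b where ab: "0 < a" "a < t" "0 < b" "b < t"
    "f (x + t *\<^sub>R u + t *\<^sub>R v) - f (x + t *\<^sub>R u) - (f (x + t *\<^sub>R v) - f x) =
      t * (t * ?F u v (x + a *\<^sub>R u + b *\<^sub>R v))"
    using second_difference_mean_value[OF f t inS] by blast
  have inS': "x + a *\<^sub>R v + b *\<^sub>R u \<in> S" if "0 \<le> a" "a \<le> t" "0 \<le> b" "b \<le> t" for a b
    using inS[OF that(3,4,1,2)] by (simp add: algebra_simps)
  obtain a' b' where ab': "0 < a'" "a' < t" "0 < b'" "b' < t"
    "f (x + t *\<^sub>R v + t *\<^sub>R u) - f (x + t *\<^sub>R v) - (f (x + t *\<^sub>R u) - f x) =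
      t * (t * ?F v u (x + a' *\<^sub>R v + b' *\<^sub>R u))"
    using second_difference_mean_value[OF f t inS'] by blast
  have "t * (t * ?F u v (x + a *\<^sub>R u + b *\<^sub>R v)) = t * (t * ?F v u (x + a' *\<^sub>R v + b' *\<^sub>R u))"
    using ab(5) ab'(5) by (simp add: algebra_simps)
  then have eq: "?F u v (x + a *\<^sub>R u + b *\<^sub>R v) = ?F v u (x + b' *\<^sub>R u + a' *\<^sub>R v)"
    using t by (simp add: algebra_simps)
  have "dist (?F u v (x + a *\<^sub>R u + b *\<^sub>R v)) (?F u v x) < \<epsilon>"
    using d1(2)[of "x + a *\<^sub>R u + b *\<^sub>R v"] inS[of a b] close[of a b] ab by (auto simp: r_def)
  moreover have "dist (?F v u (x + b' *\<^sub>R u + a' *\<^sub>R v)) (?F v u x) < \<epsilon>"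
    using d2(2)[of "x + b' *\<^sub>R u + a' *\<^sub>R v"] inS[of b' a'] close[of b' a'] ab' by (auto simp: r_def)
  ultimately have "dist (?F u v x) (?F v u x) < \<epsilon> + \<epsilon>"
    using eq by (smt (verit) dist_commute dist_triangle)
  then show False by (simp add: \<epsilon>_def)
qed

lemma second_derivative_symmetric:
  fixes f :: "'a::real_normed_vector \<Rightarrow> 'b::euclidean_space"
  assumes S: "open S" "x \<in> S" and f: "smooth_on S f"
  shows "D (\<lambda>z. D f z u) x v = D (\<lambda>z. D f z v) x u"
proof (rule euclidean_eqI)
  fix b :: 'b
  have 1: "D (\<lambda>y. f y \<bullet> b) y = (\<lambda>v. D f y v \<bullet> b)" if "y \<in> S" for y
    by (intro D_eqI has_derivative_inner_left smooth_on_has_derivative[OF f] that)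
  have 2: "D (\<lambda>z. D f z u \<bullet> b) x v = D (\<lambda>z. D f z u) x v \<bullet> b" for u v
    by (subst D_eqI[OF has_derivative_inner_left[OF smooth_on_has_derivative[OF smooth_on_D[OF f] S(2)]]]) simp
  have 3: "D (\<lambda>z. D f z u \<bullet> b) x v = D (\<lambda>z. D (\<lambda>y. f y \<bullet> b) z u) x v" for u v
    by (subst D_cong[OF S, where g = "\<lambda>z. D (\<lambda>y. f y \<bullet> b) z u"]) (simp_all add: 1)
  show "D (\<lambda>z. D f z u) x v \<bullet> b = D (\<lambda>z. D f z v) x u \<bullet> b"
    using second_derivative_symmetric_real[OF S smooth_on_inner_left[OF S(1) f], of b u v] 2 3 by metis
qed

section \<open>Families of linear maps\<close>

lemma linear_family_derivative_linear:
  fixes L :: "'a::real_normed_vector \<Rightarrow> 'e::real_vector \<Rightarrow> 'b::real_normed_vector"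
  assumes S: "open S" "x \<in> S" and lin: "\<And>y. y \<in> S \<Longrightarrow> linear (L y)"
    and L': "\<And>v. ((\<lambda>y. L y v) has_derivative L' v) (at x)"
  shows "linear (\<lambda>v. L' v h)"
proof (rule linearI)
  fix v w :: 'e and c :: real
  have "((\<lambda>y. L y (v + w)) has_derivative (\<lambda>h. L' v h + L' w h)) (at x)"
    by (rule has_derivative_transform_within_open[OF has_derivative_add[OF L' L'] S])
       (simp add: linear_add[OF lin])
  then show "L' (v + w) h = L' v h + L' w h"
    using has_derivative_unique[OF _ L'] by metis
  have "((\<lambda>y. L y (c *\<^sub>R v)) has_derivative (\<lambda>h. c *\<^sub>R L' v h)) (at x)"
    by (rule has_derivative_transform_within_open[OF has_derivative_scaleR_right[OF L'] S])
       (simp add: linear_scale[OF lin])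
  then show "L' (c *\<^sub>R v) h = c *\<^sub>R L' v h"
    using has_derivative_unique[OF _ L'] by metis
qed

text \<open>
  The product rule for evaluating a varying linear map on a varying vector. A metric, its Christoffel
  symbols and the differential of a map are families of this kind, known only through their
  values on fixed vectors; this rule and the following smoothness lemma are what allows them to be applied
  to vector fields.
\<close>

lemma linear_family_has_derivative:
  fixes L :: "'a::real_normed_vector \<Rightarrow> 'e::euclidean_space \<Rightarrow> 'b::real_normed_vector"
  assumes S: "open S" "x \<in> S" and lin: "\<And>y. y \<in> S \<Longrightarrow> linear (L y)"
    and L': "\<And>v. ((\<lambda>y. L y v) has_derivative L' v) (at x)"
    and X: "(X has_derivative X') (at x)"
  shows "((\<lambda>y. L y (X y)) has_derivative (\<lambda>h. L' (X x) h + L x (X' h))) (at x)"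
proof -
  have "((\<lambda>y. \<Sum>j\<in>Basis. (X y \<bullet> j) *\<^sub>R L y j) has_derivative
      (\<lambda>h. \<Sum>j\<in>Basis. (X x \<bullet> j) *\<^sub>R L' j h + (X' h \<bullet> j) *\<^sub>R L x j)) (at x)"
    by (intro has_derivative_sum has_derivative_scaleR has_derivative_inner_left X L')
  moreover have "(\<Sum>j\<in>Basis. (X x \<bullet> j) *\<^sub>R L' j h + (X' h \<bullet> j) *\<^sub>R L x j) = L' (X x) h + L x (X' h)" for h
    unfolding sum.distrib
    using linear_expand[OF linear_family_derivative_linear[OF S lin L'], of "X x" h]
      linear_expand[OF lin[OF S(2)], of "X' h"] by simp
  ultimately have *: "((\<lambda>y. \<Sum>j\<in>Basis. (X y \<bullet> j) *\<^sub>R L y j) has_derivative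
      (\<lambda>h. L' (X x) h + L x (X' h))) (at x)" by simp
  show ?thesis
    by (rule has_derivative_transform_within_open[OF * S]) (simp add: linear_expand[OF lin, symmetric])
qed

lemma Ck_on_linear_family:
  fixes L :: "'a::real_normed_vector \<Rightarrow> 'e::euclidean_space \<Rightarrow> 'b::real_normed_vector"
  assumes S: "open S" and lin: "\<And>y. y \<in> S \<Longrightarrow> linear (L y)"
    and L: "\<And>v. Ck_on k S (\<lambda>y. L y v)" and X: "Ck_on k S X"
  shows "Ck_on k S (\<lambda>y. L y (X y))"
proof -
  have "Ck_on k S (\<lambda>y. \<Sum>j\<in>Basis. (X y \<bullet> j) *\<^sub>R L y j)"
    by (intro Ck_on_sum Ck_on_bilinear[OF bounded_bilinear_scaleR] S
        Ck_on_bounded_linear[OF bounded_linear_inner_left] L X)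
  then show ?thesis
    by (subst Ck_on_cong[OF S]) (simp_all add: linear_expand[OF lin, symmetric])
qed

lemma smooth_on_linear_family:
  fixes L :: "'a::real_normed_vector \<Rightarrow> 'e::euclidean_space \<Rightarrow> 'b::real_normed_vector"
  assumes "open S" "\<And>y. y \<in> S \<Longrightarrow> linear (L y)" "\<And>v. smooth_on S (\<lambda>y. L y v)" "smooth_on S X"
  shows "smooth_on S (\<lambda>y. L y (X y))"
  unfolding smooth_on_def
proof
  show "Ck_on k S (\<lambda>y. L y (X y))" for k
    by (rule Ck_on_linear_family[OF assms(1,2)]) (use assms(3,4) in \<open>simp_all add: smooth_on_def\<close>)
qed

section \<open>Traces\<close>

lemma endo_trace_commute:
  fixes P :: "'e::euclidean_space \<Rightarrow> 'f::euclidean_space" and Q :: "'f \<Rightarrow> 'e"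
  assumes "linear P" "linear Q"
  shows "endo_trace (\<lambda>v. P (Q v)) = endo_trace (\<lambda>v. Q (P v))"
proof -
  have "endo_trace (\<lambda>v. P (Q v)) = (\<Sum>i\<in>Basis. \<Sum>j\<in>Basis. (Q i \<bullet> j) * (P j \<bullet> i))"
    unfolding endo_trace_def by (subst linear_expand[OF assms(1)]) (simp add: inner_sum_left)
  also have "\<dots> = (\<Sum>j\<in>Basis. \<Sum>i\<in>Basis. (P j \<bullet> i) * (Q i \<bullet> j))"
    by (subst sum.swap) (simp add: mult.commute)
  also have "\<dots> = endo_trace (\<lambda>v. Q (P v))"
    unfolding endo_trace_def by (subst (2) linear_expand[OF assms(2)]) (simp add: inner_sum_left)
  finally show ?thesis .
qed

text \<open>
  Ricci and scalar curvature are traces, so this is how their invariance under a change of coordinates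
  with differential \<open>A\<close> is reduced to that of the endomorphism being traced.
\<close>

lemma endo_trace_conjugate:
  fixes A L M :: "'e::euclidean_space \<Rightarrow> 'e"
  assumes A: "linear A" "inj A" and M: "linear M" and eq: "\<And>v. A (L v) = M (A v)"
  shows "endo_trace L = endo_trace M"
proof -
  obtain A' where A': "linear A'" "\<And>v. A' (A v) = v" "\<And>v. A (A' v) = v"
    using linear_injective_isomorphism[OF A] by blast
  have "endo_trace L = endo_trace (\<lambda>v. A' (M (A v)))" by (metis eq A'(2))
  also have "\<dots> = endo_trace (\<lambda>v. M (A (A' v)))"
    by (rule endo_trace_commute[OF A'(1) linear_compose[OF A(1) M, unfolded comp_def]])
  finally show ?thesis by (simp add: A')
qed

lemma endo_trace_add: "endo_trace (\<lambda>v. L v + M v) = endo_trace L + endo_trace M"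
  by (simp add: endo_trace_def inner_add_left sum.distrib)

lemma endo_trace_diff: "endo_trace (\<lambda>v. L v - M v) = endo_trace L - endo_trace M"
  by (simp add: endo_trace_def inner_diff_left sum_subtractf)

lemma endo_trace_scaleR: "endo_trace (\<lambda>v. c *\<^sub>R L v) = c * endo_trace L"
  by (simp add: endo_trace_def sum_distrib_left)

section \<open>Representing linear forms by vectors\<close>

lemma bilinear_linear_left: "bilinear b \<Longrightarrow> linear (\<lambda>v. b v w)"
  and bilinear_linear_right: "bilinear b \<Longrightarrow> linear (\<lambda>w. b v w)"
  by (simp_all add: bilinear_def)

locale inner_form =
  fixes b :: "'e::euclidean_space \<Rightarrow> 'e \<Rightarrow> real"
  assumes bil: "bilinear b" and sym: "b v w = b w v" and pos: "v \<noteq> 0 \<Longrightarrow> b v v > 0"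
begin

lemmas lin_left = bilinear_linear_left[OF bil] and lin_right = bilinear_linear_right[OF bil]
lemmas ladd = bilinear_ladd[OF bil] and radd = bilinear_radd[OF bil]
  and lsub = bilinear_lsub[OF bil]
  and lmul = bilinear_lmul[OF bil] and rmul = bilinear_rmul[OF bil]

lemma nondegenerate: assumes "\<And>w. b v w = b v' w" shows "v = v'"
  using assms[of "v - v'"] pos[of "v - v'"] lsub[of v v' "v - v'"] by (cases "v = v'") auto

lemma sharp_eqI: "(\<And>w. b v w = \<alpha> w) \<Longrightarrow> sharp b \<alpha> = v"
  unfolding sharp_def by (rule the_equality) (auto intro: nondegenerate)

lemma represented_by_vector:
  assumes "linear \<alpha>" shows "\<exists>v. \<forall>w. b v w = \<alpha> w"
proof -
  define L where "L = (\<lambda>v. \<Sum>j\<in>Basis. b v j *\<^sub>R j)"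
  have "linear L"
    by (rule linearI) (simp_all add: L_def ladd lmul scaleR_add_left sum.distrib scaleR_sum_right)
  have Lb: "L v \<bullet> w = b v w" for v w
    unfolding L_def linear_expand[OF lin_right, of v w]
    by (simp add: inner_sum_left inner_commute[of w] mult.commute)
  have "inj L"
    unfolding linear_injective_0[OF \<open>linear L\<close>] by (metis Lb inner_zero_left less_irrefl pos)
  then obtain v where "L v = (\<Sum>j\<in>Basis. \<alpha> j *\<^sub>R j)"
    using linear_injective_imp_surjective[OF \<open>linear L\<close>] by (metis surjD)
  then have "b v w = \<alpha> w" for w
    unfolding Lb[symmetric] linear_expand[OF assms, of w]
    by (simp add: inner_sum_left inner_commute[of w] mult.commute)
  then show ?thesis by blast
qed

lemma sharp_works: "linear \<alpha> \<Longrightarrow> b (sharp b \<alpha>) w = \<alpha> w"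
  using represented_by_vector[of \<alpha>] sharp_eqI by metis

lemma linear_sharp:
  assumes "\<And>v. linear (\<alpha> v)" "\<And>w. linear (\<lambda>v. \<alpha> v w)"
  shows "linear (\<lambda>v. sharp b (\<alpha> v))"
  by (rule linearI; rule sharp_eqI)
     (simp_all add: ladd lmul sharp_works assms linear_add[OF assms(2)] linear_scale[OF assms(2)])

text \<open>
  The minimum of the quadratic form on the unit sphere is positive, by compactness.
\<close>

lemma coercive: "\<exists>c>0. \<forall>v. c * (norm v)\<^sup>2 \<le> b v v"
proof -
  interpret bounded_bilinear b using bil bilinear_conv_bounded_bilinear by blast
  have cont: "continuous_on (sphere 0 1) (\<lambda>v. b v v)"
    by (intro continuous_on continuous_on_id)
  have ne: "sphere (0::'e) 1 \<noteq> {}" using nonempty_Basis by (force simp: norm_Basis)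
  obtain u where u: "u \<in> sphere 0 1" "\<And>v. v \<in> sphere 0 1 \<Longrightarrow> b u u \<le> b v v"
    using continuous_attains_inf[OF compact_sphere ne cont] by blast
  have "b u u * (norm v)\<^sup>2 \<le> b v v" for v
  proof (cases "v = 0")
    case True then show ?thesis by (simp add: zero_left)
  next
    case False
    have "b u u \<le> b (inverse (norm v) *\<^sub>R v) (inverse (norm v) *\<^sub>R v)"
      using False by (intro u(2)) simp
    also have "\<dots> = b v v / (norm v)\<^sup>2"
      by (simp add: scaleR_left scaleR_right divide_inverse power2_eq_square)
    finally show ?thesis using False by (simp add: field_simps)
  qed
  moreover have "b u u > 0" using u(1) by (intro pos) auto
  ultimately show ?thesis by blast
qed

end

section \<open>Metrics on open subsets of a Euclidean space\<close>

locale metric_on =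
  fixes S :: "'e::euclidean_space set" and G :: "'e \<Rightarrow> 'e \<Rightarrow> 'e \<Rightarrow> real"
  assumes open_S [simp, intro]: "open S"
    and inner_form: "x \<in> S \<Longrightarrow> inner_form (G x)"
    and smooth: "smooth_on S (\<lambda>x. G x v w)"
begin

lemmas lin_left = inner_form.lin_left[OF inner_form] and lin_right = inner_form.lin_right[OF inner_form]
lemmas ladd = inner_form.ladd[OF inner_form] and radd = inner_form.radd[OF inner_form]
  and lsub = inner_form.lsub[OF inner_form]
  and lmul = inner_form.lmul[OF inner_form] and rmul = inner_form.rmul[OF inner_form]
  and sym = inner_form.sym[OF inner_form]
  and sharp_works = inner_form.sharp_works[OF inner_form]
  and sharp_eqI = inner_form.sharp_eqI[OF inner_form]

abbreviation DG :: "'e \<Rightarrow> 'e \<Rightarrow> 'e \<Rightarrow> 'e \<Rightarrow> real" where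
  "DG x u v w \<equiv> D (\<lambda>y. G y v w) x u"

lemma G_has_derivative: "x \<in> S \<Longrightarrow> ((\<lambda>y. G y v w) has_derivative (\<lambda>u. DG x u v w)) (at x)"
  by (rule smooth_on_has_derivative[OF smooth])

lemma DG_linear:
  assumes "x \<in> S"
  shows "linear (\<lambda>u. DG x u v w)" "linear (\<lambda>v. DG x u v w)" "linear (\<lambda>w. DG x u v w)"
  using has_derivative_linear[OF G_has_derivative[OF assms]]
    linear_family_derivative_linear[OF open_S assms lin_left G_has_derivative[OF assms]]
    linear_family_derivative_linear[OF open_S assms lin_right G_has_derivative[OF assms]]
  by blast+

lemma G_product_rule:
  assumes "x \<in> S" "(X has_derivative X') (at x)" "(Y has_derivative Y') (at x)"
  shows "((\<lambda>y. G y (X y) (Y y)) has_derivative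
     (\<lambda>h. DG x h (X x) (Y x) + G x (X' h) (Y x) + G x (X x) (Y' h))) (at x)"
proof -
  have "((\<lambda>y. G y (X y) w) has_derivative (\<lambda>h. DG x h (X x) w + G x (X' h) w)) (at x)" for w
    by (rule linear_family_has_derivative[OF open_S assms(1) lin_left G_has_derivative[OF assms(1)] assms(2)])
  from linear_family_has_derivative[OF open_S assms(1) lin_right this assms(3)]
  show ?thesis by simp
qed

text \<open>
  Coercivity of \<open>G x0\<close> persists with half the constant for nearby \<open>x\<close>, so a vector is controlled,
  uniformly near \<open>x0\<close>, by the linear form that it represents. This is the only estimate behind the regularity
  of \<open>sharp\<close>.
\<close>

lemma norm_le_sum_components:
  assumes "x0 \<in> S"
  obtains C T where "open T" "x0 \<in> T" "T \<subseteq> S"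
    "\<And>x v. x \<in> T \<Longrightarrow> norm v \<le> C * (\<Sum>i\<in>Basis. \<bar>G x v i\<bar>)"
proof -
  obtain c where c: "c > 0" "\<And>v. c * (norm v)\<^sup>2 \<le> G x0 v v"
    using inner_form.coercive[OF inner_form[OF assms]] by blast
  define e where "e = (\<lambda>x. \<Sum>i\<in>Basis. \<Sum>j\<in>Basis. \<bar>G x i j - G x0 i j\<bar>)"
  have "continuous_on S e"
    unfolding e_def by (intro continuous_intros smooth_on_continuous[OF smooth])
  then have "open (S \<inter> e -` {..<c/2})"
    by (rule continuous_open_preimage) auto
  moreover have "x0 \<in> S \<inter> e -` {..<c/2}" using assms c by (simp add: e_def)
  moreover have "norm v \<le> 2 / c * (\<Sum>i\<in>Basis. \<bar>G x v i\<bar>)" if x: "x \<in> S \<inter> e -` {..<c/2}" for x v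
  proof (cases "v = 0")
    case True
    then show ?thesis using c(1) by (simp add: sum_nonneg)
  next
    case False
    have xS: "x \<in> S" and ex: "e x < c / 2" using x by auto
    have expand: "G y v v = (\<Sum>i\<in>Basis. \<Sum>j\<in>Basis. (v \<bullet> i) * (v \<bullet> j) * G y i j)" if "y \<in> S" for y
    proof -
      have "G y v v = (\<Sum>i\<in>Basis. (v \<bullet> i) * G y i v)"
        using linear_expand[OF lin_left[OF that], of v v] by simp
      also have "\<dots> = (\<Sum>i\<in>Basis. (v \<bullet> i) * (\<Sum>j\<in>Basis. (v \<bullet> j) * G y i j))"
        using linear_expand[OF lin_right[OF that], of _ v] by simp
      finally show ?thesis by (simp add: sum_distrib_left mult.assoc)
    qed
    have "\<bar>G x v v - G x0 v v\<bar> = \<bar>\<Sum>i\<in>Basis. \<Sum>j\<in>Basis. (v \<bullet> i) * (v \<bullet> j) * (G x i j - G x0 i j)\<bar>"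
      by (simp add: expand[OF xS] expand[OF assms] right_diff_distrib sum_subtractf)
    also have "\<dots> \<le> (\<Sum>i\<in>Basis. \<Sum>j\<in>Basis. \<bar>(v \<bullet> i) * (v \<bullet> j) * (G x i j - G x0 i j)\<bar>)"
      by (intro order_trans[OF sum_abs] sum_mono sum_abs)
    also have "\<dots> \<le> (\<Sum>i\<in>Basis. \<Sum>j\<in>Basis. (norm v * norm v) * \<bar>G x i j - G x0 i j\<bar>)"
      unfolding abs_mult by (intro sum_mono mult_right_mono mult_mono Basis_le_norm) auto
    also have "\<dots> = e x * (norm v)\<^sup>2"
      by (simp add: e_def sum_distrib_left sum_distrib_right power2_eq_square mult.commute)
    also have "\<dots> \<le> c / 2 * (norm v)\<^sup>2"
      using ex by (intro mult_right_mono) auto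
    finally have "c / 2 * (norm v)\<^sup>2 \<le> G x v v"
      using c(2)[of v] by linarith
    also have "G x v v = (\<Sum>i\<in>Basis. (v \<bullet> i) * G x v i)"
      using linear_expand[OF lin_right[OF xS], of v v] by simp
    also have "\<dots> \<le> (\<Sum>i\<in>Basis. \<bar>(v \<bullet> i) * G x v i\<bar>)" by (intro sum_mono) simp
    also have "\<dots> \<le> (\<Sum>i\<in>Basis. norm v * \<bar>G x v i\<bar>)"
      unfolding abs_mult by (intro sum_mono mult_right_mono Basis_le_norm) auto
    finally have "norm v * (c / 2 * norm v) \<le> norm v * (\<Sum>i\<in>Basis. \<bar>G x v i\<bar>)"
      by (simp add: sum_distrib_left power2_eq_square mult_ac)
    then have "c / 2 * norm v \<le> (\<Sum>i\<in>Basis. \<bar>G x v i\<bar>)" using False by simp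
    then show ?thesis using c(1) by (simp add: field_simps)
  qed
  ultimately show thesis using that[of "S \<inter> e -` {..<c/2}" "2/c"] by blast
qed

text \<open>
  The vector \<open>sharp (G y) (\<alpha> y) - sharp (G x) (\<alpha> x)\<close> represents, for \<open>G y\<close>, a linear form that tends to 0 as
  \<open>y\<close> tends to \<open>x\<close>.
\<close>

lemma continuous_on_sharp:
  assumes lin: "\<And>y. y \<in> S \<Longrightarrow> linear (\<alpha> y)" and \<alpha>: "\<And>w. continuous_on S (\<lambda>y. \<alpha> y w)"
  shows "continuous_on S (\<lambda>y. sharp (G y) (\<alpha> y))"
  unfolding continuous_on_eq_continuous_at[OF open_S] isCont_def
proof (intro ballI)
  fix x assume x: "x \<in> S"
  let ?X = "\<lambda>y. sharp (G y) (\<alpha> y)"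
  obtain T C where CT: "open T" "x \<in> T" "T \<subseteq> S"
    "\<And>x v. x \<in> T \<Longrightarrow> norm v \<le> C * (\<Sum>i\<in>Basis. \<bar>G x v i\<bar>)"
    by (rule norm_le_sum_components[OF x], rule that)
  have "norm (?X y - ?X x) \<le> C * (\<Sum>i\<in>Basis. \<bar>\<alpha> y i - G y (?X x) i\<bar>)" if "y \<in> T" for y
    using CT(4)[OF that, of "?X y - ?X x"] CT(3) that by (simp add: lsub sharp_works lin subset_iff)
  then have bound: "eventually (\<lambda>y. norm (?X y - ?X x) \<le> C * (\<Sum>i\<in>Basis. \<bar>\<alpha> y i - G y (?X x) i\<bar>)) (at x)"
    using CT(1,2) unfolding eventually_at_topological by blast
  moreover have "((\<lambda>y. C * (\<Sum>i\<in>Basis. \<bar>\<alpha> y i - G y (?X x) i\<bar>)) \<longlongrightarrow> C * (\<Sum>i\<in>Basis. \<bar>\<alpha> x i - G x (?X x) i\<bar>)) (at x)"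
    using \<alpha> smooth_on_continuous[OF smooth] x
    by (intro tendsto_intros) (auto simp: continuous_on_eq_continuous_at isCont_def)
  moreover have "C * (\<Sum>i\<in>Basis. \<bar>\<alpha> x i - G x (?X x) i\<bar>) = 0"
    by (simp add: sharp_works x lin)
  ultimately have "((\<lambda>y. C * (\<Sum>i\<in>Basis. \<bar>\<alpha> y i - G y (?X x) i\<bar>)) \<longlongrightarrow> 0) (at x)"
    by simp
  then show "(?X \<longlongrightarrow> ?X x) (at x)"
    by (intro LIM_zero_cancel[OF Lim_null_comparison[OF bound]])
qed

text \<open>
  The formula comes from differentiating \<open>G y (sharp (G y) (\<alpha> y)) w = \<alpha> y w\<close>. That the
  derivative exists is seen from the remainder \<open>r\<close>: the linear form that it represents has components \<open>\<rho> i\<close>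
  with vanishing derivative at \<open>x\<close>, and \<open>r\<close> is bounded by them.
\<close>

lemma sharp_has_derivative:
  assumes x: "x \<in> S" and lin: "\<And>y. y \<in> S \<Longrightarrow> linear (\<alpha> y)"
    and \<alpha>: "\<And>w. ((\<lambda>y. \<alpha> y w) has_derivative \<alpha>' w) (at x)"
  shows "((\<lambda>y. sharp (G y) (\<alpha> y)) has_derivative
    (\<lambda>h. sharp (G x) (\<lambda>w. \<alpha>' w h - DG x h (sharp (G x) (\<alpha> x)) w))) (at x)"
proof -
  let ?X = "\<lambda>y. sharp (G y) (\<alpha> y)"
  define \<beta>' where "\<beta>' = (\<lambda>h w. \<alpha>' w h - DG x h (?X x) w)"
  define Y where "Y = (\<lambda>h. sharp (G x) (\<beta>' h))"
  have lin1: "linear (\<beta>' h)" for h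
    unfolding \<beta>'_def
    by (intro linear_compose_sub DG_linear[OF x] linear_family_derivative_linear[OF open_S x lin \<alpha>])
  have lin2: "linear (\<lambda>h. \<beta>' h w)" for w
    unfolding \<beta>'_def by (intro linear_compose_sub DG_linear[OF x] has_derivative_linear[OF \<alpha>])
  have Y: "linear Y"
    unfolding Y_def by (rule inner_form.linear_sharp[OF inner_form[OF x] lin1 lin2])
  have Y': "((\<lambda>y. Y (y - x)) has_derivative Y) (at x)"
    using bounded_linear.has_derivative[OF linear_conv_bounded_linear[THEN iffD1, OF Y]
        has_derivative_diff[OF has_derivative_ident has_derivative_const[of x]]] by simp
  obtain T C where CT: "open T" "x \<in> T" "T \<subseteq> S"
    "\<And>x v. x \<in> T \<Longrightarrow> norm v \<le> C * (\<Sum>i\<in>Basis. \<bar>G x v i\<bar>)"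
    by (rule norm_le_sum_components[OF x], rule that)
  \<comment> \<open>the remainder, and the components of the linear form that it represents\<close>
  define r where "r = (\<lambda>y. ?X y - ?X x - Y (y - x))"
  define \<rho> where "\<rho> = (\<lambda>i y. \<alpha> y i - G y (?X x) i - G y (Y (y - x)) i)"
  have r: "G y (r y) i = \<rho> i y" if "y \<in> S" for y i
    by (simp add: r_def \<rho>_def lsub sharp_works lin that)
  have \<rho>: "(\<rho> i has_derivative (\<lambda>h. 0)) (at x)" for i
  proof -
    have "(\<rho> i has_derivative
       (\<lambda>h. \<alpha>' i h - DG x h (?X x) i - (DG x h (Y (x - x)) i + G x (Y h) i))) (at x)"
      unfolding \<rho>_def
      by (intro has_derivative_diff \<alpha> G_has_derivative x
          linear_family_has_derivative[OF open_S x, where L = "\<lambda>y v. G y v i"] lin_left Y')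
    moreover have "\<alpha>' i h - DG x h (?X x) i - (DG x h (Y (x - x)) i + G x (Y h) i) = 0" for h
      using linear_0[OF Y] linear_0[OF DG_linear(2)[OF x]] sharp_works[OF x lin1, of h i]
      by (simp add: Y_def \<beta>'_def)
    ultimately show ?thesis by simp
  qed
  have \<rho>0: "\<rho> i x = 0" for i
    using linear_0[OF Y] linear_0[OF lin_left[OF x]] by (simp add: \<rho>_def sharp_works x lin)
  have "((\<lambda>y. norm (\<rho> i y) / norm (y - x)) \<longlongrightarrow> 0) (at x)" for i
    using \<rho>[of i] by (simp add: has_derivative_iff_norm \<rho>0)
  then have "((\<lambda>y. C * (\<Sum>i\<in>Basis. norm (\<rho> i y) / norm (y - x))) \<longlongrightarrow> C * (\<Sum>i\<in>(Basis::'e set). 0)) (at x)"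
    by (intro tendsto_intros)
  then have lim: "((\<lambda>y. C * (\<Sum>i\<in>Basis. norm (\<rho> i y) / norm (y - x))) \<longlongrightarrow> 0) (at x)"
    by simp
  have "norm (norm (r y) / norm (y - x)) \<le> C * (\<Sum>i\<in>Basis. norm (\<rho> i y) / norm (y - x))" if "y \<in> T" for y
    using divide_right_mono[OF CT(4)[OF that, of "r y"], of "norm (y - x)"] CT(3) that
    by (auto simp: r sum_divide_distrib[symmetric] subset_iff)
  then have "eventually (\<lambda>y. norm (norm (r y) / norm (y - x)) \<le> C * (\<Sum>i\<in>Basis. norm (\<rho> i y) / norm (y - x))) (at x)"
    using CT(1,2) unfolding eventually_at_topological by blast
  from Lim_null_comparison[OF this lim]
  have "((\<lambda>y. norm (?X y - ?X x - Y (y - x)) / norm (y - x)) \<longlongrightarrow> 0) (at x)"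
    by (simp add: r_def)
  then have "(?X has_derivative Y) (at x)"
    using Y by (simp add: has_derivative_iff_norm linear_conv_bounded_linear)
  then show ?thesis unfolding Y_def \<beta>'_def .
qed

text \<open>
  The derivative of \<open>sharp (G y) (\<alpha> y)\<close> is again of the form \<open>sharp (G y) (\<beta> y)\<close>, where \<open>\<beta>\<close> involves the
  vector field itself and the derivative of \<open>\<alpha>\<close>; hence the induction has to run over all \<open>\<alpha>\<close> at once.
\<close>

lemma Ck_on_sharp:
  assumes "\<And>y. y \<in> S \<Longrightarrow> linear (\<alpha> y)" "\<And>w. Ck_on k S (\<lambda>y. \<alpha> y w)"
  shows "Ck_on k S (\<lambda>y. sharp (G y) (\<alpha> y))"
  using assms
proof (induction k arbitrary: \<alpha>)
  case 0
  then show ?case using continuous_on_sharp by simp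
next
  case (Suc k)
  let ?X = "\<lambda>y. sharp (G y) (\<alpha> y)"
  have \<alpha>: "((\<lambda>y. \<alpha> y w) has_derivative D (\<lambda>y. \<alpha> y w) y) (at y)" if "y \<in> S" for y w
    using Ck_on_SucD(1)[OF Suc.prems(2) that] .
  have X: "Ck_on k S ?X"
    by (rule Suc.IH[OF Suc.prems(1) Ck_on_pred[OF Suc.prems(2)]])
  have "Ck_on k S (\<lambda>y. sharp (G y) (\<lambda>w. D (\<lambda>y. \<alpha> y w) y h - DG y h (?X y) w))" for h
  proof (rule Suc.IH)
    show "linear (\<lambda>w. D (\<lambda>y. \<alpha> y w) y h - DG y h (?X y) w)" if "y \<in> S" for y
      using linear_family_derivative_linear[OF open_S that Suc.prems(1) \<alpha>[OF that]]
      by (intro linear_compose_sub DG_linear[OF that])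
    have DG: "Ck_on k S (\<lambda>y. DG y h v w)" for v w
      using smooth_on_D[OF smooth] by (simp add: smooth_on_def)
    have "Ck_on k S (\<lambda>y. DG y h (?X y) w)" for w
      by (rule Ck_on_linear_family[OF open_S DG_linear(2) DG X])
    then have "Ck_on k S (\<lambda>y. D (\<lambda>y. \<alpha> y w) y h + - DG y h (?X y) w)" for w
      by (intro Ck_on_add Ck_on_bounded_linear[OF bounded_linear_minus[OF bounded_linear_ident]]
           open_S Ck_on_SucD(2)[OF Suc.prems(2)])
    then show "Ck_on k S (\<lambda>y. D (\<lambda>y. \<alpha> y w) y h - DG y h (?X y) w)" for w by simp
  qed
  then show ?case
    using sharp_has_derivative[OF _ Suc.prems(1) \<alpha>] by (intro Ck_on_SucI[OF open_S])
qed

lemma smooth_on_sharp: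
  "(\<And>y. y \<in> S \<Longrightarrow> linear (\<alpha> y)) \<Longrightarrow> (\<And>w. smooth_on S (\<lambda>y. \<alpha> y w)) \<Longrightarrow>
    smooth_on S (\<lambda>y. sharp (G y) (\<alpha> y))"
  unfolding smooth_on_def by (rule allI, rule Ck_on_sharp) simp_all

end

section \<open>Curvature, gradient, Hessian and Laplacian in coordinates\<close>

definition local_grad :: "('e::euclidean_space \<Rightarrow> 'e \<Rightarrow> 'e \<Rightarrow> real) \<Rightarrow> ('e \<Rightarrow> real) \<Rightarrow> 'e \<Rightarrow> 'e" where
  "local_grad G U x = sharp (G x) (D U x)"

definition local_hess ::
  "('e::euclidean_space \<Rightarrow> 'e \<Rightarrow> 'e \<Rightarrow> real) \<Rightarrow> ('e \<Rightarrow> real) \<Rightarrow> 'e \<Rightarrow> 'e \<Rightarrow> 'e \<Rightarrow> real" where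
  "local_hess G U x a b = D (\<lambda>y. D U y b) x a - D U x (christoffel G x a b)"

definition local_laplacian :: "('e::euclidean_space \<Rightarrow> 'e \<Rightarrow> 'e \<Rightarrow> real) \<Rightarrow> ('e \<Rightarrow> real) \<Rightarrow> 'e \<Rightarrow> real" where
  "local_laplacian G U x = endo_trace (covariant_deriv G (local_grad G U) x)"

text \<open>
  The iterated covariant derivative \<open>\<nabla>\<^sub>u \<nabla>\<^sub>v w\<close> for constant vector fields. Changes of coordinates and warped
  products are computed for it first: most of the terms that appear are symmetric in \<open>u\<close> and \<open>v\<close>
  and cancel in the curvature.
\<close>

definition nabla_christoffel ::
  "('e::euclidean_space \<Rightarrow> 'e \<Rightarrow> 'e \<Rightarrow> real) \<Rightarrow> 'e \<Rightarrow> 'e \<Rightarrow> 'e \<Rightarrow> 'e \<Rightarrow> 'e" where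
  "nabla_christoffel G x u v w = covariant_deriv G (\<lambda>y. christoffel G y v w) x u"

lemma riemann_eq: "riemann G x u v w = nabla_christoffel G x u v w - nabla_christoffel G x v u w"
  by (simp add: riemann_def nabla_christoffel_def)

context metric_on
begin

abbreviation "\<Gamma> \<equiv> christoffel G"

lemma koszul_linear: "x \<in> S \<Longrightarrow> linear (\<lambda>z. (DG x v w z + DG x w v z - DG x z v w) / 2)"
  by (rule linearI)
     (simp_all add: DG_linear[THEN linear_add] DG_linear[THEN linear_scale] field_simps)

lemma christoffel_works:
  "x \<in> S \<Longrightarrow> 2 * G x (\<Gamma> x v w) z = DG x v w z + DG x w v z - DG x z v w"
  unfolding christoffel_def by (simp add: sharp_works koszul_linear)

lemma christoffel_eqI:
  assumes "x \<in> S" "\<And>z. 2 * G x V z = DG x v w z + DG x w v z - DG x z v w"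
  shows "\<Gamma> x v w = V"
proof -
  have "G x V z = (DG x v w z + DG x w v z - DG x z v w) / 2" for z
    using assms(2)[of z] by simp
  then show ?thesis unfolding christoffel_def by (rule sharp_eqI[OF assms(1)])
qed

lemma DG_sym: "x \<in> S \<Longrightarrow> DG x u v w = DG x u w v"
  using D_cong[OF open_S, of x "\<lambda>y. G y v w" "\<lambda>y. G y w v"] sym by simp

lemma christoffel_sym: "x \<in> S \<Longrightarrow> \<Gamma> x v w = \<Gamma> x w v"
  by (rule christoffel_eqI) (simp_all add: christoffel_works DG_sym[where v = w and w = v])

lemma christoffel_linear_left: "x \<in> S \<Longrightarrow> linear (\<lambda>v. \<Gamma> x v w)"
  by (rule linearI; rule christoffel_eqI)
     (simp_all add: ladd lmul distrib_left mult.left_commute[of 2] christoffel_works DG_linear[THEN linear_add] DG_linear[THEN linear_scale]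
       , simp_all add: algebra_simps)

lemma christoffel_linear_right: "x \<in> S \<Longrightarrow> linear (\<lambda>w. \<Gamma> x v w)"
  using christoffel_linear_left[of x v] christoffel_sym[of x v] by simp

text \<open>
  The Koszul formulas of the two terms on the right add up to \<open>DG x u v w\<close>.
\<close>

lemma metric_compatible:
  "x \<in> S \<Longrightarrow> DG x u v w = G x (\<Gamma> x u v) w + G x v (\<Gamma> x u w)"
  using sym[of x v "\<Gamma> x u w"] christoffel_works[of x u v w] christoffel_works[of x u w v]
    DG_sym[of x w v u] by simp

lemma christoffel_smooth: "smooth_on S (\<lambda>x. \<Gamma> x v w)"
proof -
  have "smooth_on S (\<lambda>y. (DG y v w z + DG y w v z - DG y z v w) / 2)" for z
    unfolding divide_inverse
    by (intro smooth_on_mult smooth_on_diff smooth_on_add smooth_on_D smooth smooth_on_const open_S)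
  then show ?thesis
    unfolding christoffel_def by (intro smooth_on_sharp koszul_linear)
qed

lemma christoffel_has_derivative:
  "x \<in> S \<Longrightarrow> ((\<lambda>y. \<Gamma> y v w) has_derivative (\<lambda>u. D (\<lambda>y. \<Gamma> y v w) x u)) (at x)"
  by (rule smooth_on_has_derivative[OF christoffel_smooth])

lemma nabla_christoffel_eq:
  "nabla_christoffel G x u v w = D (\<lambda>y. \<Gamma> y v w) x u + \<Gamma> x u (\<Gamma> x v w)"
  by (simp add: nabla_christoffel_def covariant_deriv_def)

lemma nabla_christoffel_linear:
  assumes "x \<in> S"
  shows "linear (\<lambda>u. nabla_christoffel G x u v w)" "linear (\<lambda>v. nabla_christoffel G x u v w)"
    "linear (\<lambda>w. nabla_christoffel G x u v w)"
  unfolding nabla_christoffel_eq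
  using has_derivative_linear[OF christoffel_has_derivative[OF assms]]
    linear_family_derivative_linear[OF open_S assms christoffel_linear_left christoffel_has_derivative[OF assms]]
    linear_family_derivative_linear[OF open_S assms christoffel_linear_right christoffel_has_derivative[OF assms]]
    christoffel_linear_left[OF assms]
    linear_compose[OF christoffel_linear_left[OF assms] christoffel_linear_right[OF assms], unfolded comp_def]
    linear_compose[OF christoffel_linear_right[OF assms] christoffel_linear_right[OF assms], unfolded comp_def]
  by (intro linear_compose_add; simp)+

lemma riemann_linear:
  assumes "x \<in> S"
  shows "linear (\<lambda>u. riemann G x u v w)" "linear (\<lambda>v. riemann G x u v w)" "linear (\<lambda>w. riemann G x u v w)"
  unfolding riemann_eq by (intro linear_compose_sub nabla_christoffel_linear assms)+

lemma ricci_linear: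
  assumes "x \<in> S"
  shows "linear (\<lambda>v. ricci G x v w)" "linear (\<lambda>w. ricci G x v w)"
  unfolding ricci_def endo_trace_def
  by (rule linearI; simp add: linear_add[OF riemann_linear(2)[OF assms]] linear_scale[OF riemann_linear(2)[OF assms]]
     linear_add[OF riemann_linear(3)[OF assms]] linear_scale[OF riemann_linear(3)[OF assms]]
     inner_add_left sum.distrib sum_distrib_left)+

lemma ricci_sharp_linear: "x \<in> S \<Longrightarrow> linear (\<lambda>v. sharp (G x) (ricci G x v))"
  by (rule inner_form.linear_sharp[OF inner_form]) (auto intro: ricci_linear)

context
  fixes U :: "'e \<Rightarrow> real" assumes U: "smooth_on S U"
begin

lemma deriv_linear: "x \<in> S \<Longrightarrow> linear (D U x)"
  by (rule has_derivative_linear[OF smooth_on_has_derivative[OF U]])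

lemma G_local_grad: "x \<in> S \<Longrightarrow> G x (local_grad G U x) w = D U x w"
  unfolding local_grad_def by (simp add: sharp_works deriv_linear)

lemma local_grad_smooth: "smooth_on S (local_grad G U)"
  using smooth_on_sharp[of "D U"] smooth_on_D[OF U] deriv_linear unfolding local_grad_def[abs_def] by simp

lemma local_grad_has_derivative:
  "x \<in> S \<Longrightarrow> (local_grad G U has_derivative D (local_grad G U) x) (at x)"
  by (rule smooth_on_has_derivative[OF local_grad_smooth])

lemma local_hess_linear:
  assumes "x \<in> S"
  shows "linear (\<lambda>a. local_hess G U x a b)" "linear (\<lambda>b. local_hess G U x a b)"
  unfolding local_hess_def
  using has_derivative_linear[OF smooth_on_has_derivative[OF smooth_on_D[OF U] assms]]
    linear_family_derivative_linear[OF open_S assms deriv_linear smooth_on_has_derivative[OF smooth_on_D[OF U] assms]]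
    linear_compose[OF christoffel_linear_left[OF assms] deriv_linear[OF assms], unfolded comp_def]
    linear_compose[OF christoffel_linear_right[OF assms] deriv_linear[OF assms], unfolded comp_def]
  by (intro linear_compose_sub; simp)+

text \<open>
  Differentiating \<open>G y (local_grad G U y) w = D U y w\<close> in direction \<open>v\<close> and using metric compatibility.
\<close>

lemma G_covariant_deriv_grad:
  assumes "x \<in> S"
  shows "G x (covariant_deriv G (local_grad G U) x v) w = local_hess G U x v w"
proof -
  have "((\<lambda>y. G y (local_grad G U y) w) has_derivative
    (\<lambda>h. DG x h (local_grad G U x) w + G x (D (local_grad G U) x h) w + G x (local_grad G U x) 0)) (at x)"
    by (intro G_product_rule local_grad_has_derivative has_derivative_const assms)
  then have "((\<lambda>y. D U y w) has_derivative
    (\<lambda>h. DG x h (local_grad G U x) w + G x (D (local_grad G U) x h) w + G x (local_grad G U x) 0)) (at x)"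
    by (rule has_derivative_transform_within_open[OF _ open_S assms]) (simp add: G_local_grad)
  from D_eqI[OF this]
  have "D (\<lambda>y. D U y w) x v = DG x v (local_grad G U x) w + G x (D (local_grad G U) x v) w"
    by (simp add: linear_0[OF lin_right[OF assms]])
  then show ?thesis
    unfolding local_hess_def covariant_deriv_def
    by (simp add: ladd assms metric_compatible G_local_grad)
qed

text \<open>
  Thus the divergence of the gradient is the trace of the Hessian, which is how the Laplacian is handled below.
\<close>

lemma covariant_deriv_grad:
  assumes "x \<in> S"
  shows "covariant_deriv G (local_grad G U) x v = sharp (G x) (local_hess G U x v)"
  using sharp_eqI[OF assms G_covariant_deriv_grad[OF assms]] by simp

lemma local_laplacian_eq:
  "x \<in> S \<Longrightarrow> local_laplacian G U x = endo_trace (\<lambda>v. sharp (G x) (local_hess G U x v))"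
  unfolding local_laplacian_def endo_trace_def by (simp add: covariant_deriv_grad)

lemma hess_sharp_linear: "x \<in> S \<Longrightarrow> linear (\<lambda>v. sharp (G x) (local_hess G U x v))"
  by (rule inner_form.linear_sharp[OF inner_form]) (auto intro: local_hess_linear)

lemma local_laplacian_smooth: "smooth_on S (local_laplacian G U)"
  unfolding local_laplacian_def[abs_def] endo_trace_def covariant_deriv_def
  by (intro smooth_on_sum smooth_on_inner_left smooth_on_add smooth_on_D local_grad_smooth open_S
     smooth_on_linear_family[OF open_S christoffel_linear_right christoffel_smooth])

end

end

section \<open>Invariance under changes of coordinates\<close>

text \<open>
  A map that pulls \<open>H\<close> back to \<open>G\<close>. Its differential is injective since \<open>G\<close> is positive definite,
  hence bijective for reasons of dimension, so that no inverse map has to be supplied. The main examples are the transition maps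
  between charts; the identity is used to compare two metrics that agree only on an open set.
\<close>

locale local_isometry = dom: metric_on S G + cod: metric_on T H
  for S :: "'e::euclidean_space set" and G and T :: "'e set" and H +
  fixes \<psi> :: "'e \<Rightarrow> 'e"
  assumes \<psi>: "smooth_on S \<psi>" and maps: "x \<in> S \<Longrightarrow> \<psi> x \<in> T"
    and isometric: "x \<in> S \<Longrightarrow> G x v w = H (\<psi> x) (D \<psi> x v) (D \<psi> x w)"
begin

lemmas open_S = dom.open_S

abbreviation "A \<equiv> D \<psi>"
abbreviation "D2 x v w \<equiv> D (\<lambda>y. D \<psi> y w) x v"

lemma psi_has_derivative: "x \<in> S \<Longrightarrow> (\<psi> has_derivative A x) (at x)"
  by (rule smooth_on_has_derivative[OF \<psi>])

lemma A_has_derivative: "x \<in> S \<Longrightarrow> ((\<lambda>y. A y w) has_derivative (\<lambda>v. D2 x v w)) (at x)"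
  by (rule smooth_on_has_derivative[OF smooth_on_D[OF \<psi>]])

lemma A_linear: "x \<in> S \<Longrightarrow> linear (A x)"
  by (rule has_derivative_linear[OF psi_has_derivative])

lemma A_inj: assumes "x \<in> S" shows "inj (A x)"
  unfolding linear_injective_0[OF A_linear[OF assms]]
proof (intro allI impI)
  fix v assume "A x v = 0"
  then have "G x v v = 0"
    using isometric[OF assms, of v v] linear_0[OF cod.lin_left[OF maps[OF assms]]] by simp
  then show "v = 0" using inner_form.pos[OF dom.inner_form[OF assms], of v] by force
qed

lemma A_surj: assumes "x \<in> S" obtains v where "w = A x v"
  using linear_injective_imp_surjective[OF A_linear[OF assms] A_inj[OF assms]] by (metis surjD)

lemma D2_sym: "x \<in> S \<Longrightarrow> D2 x v w = D2 x w v"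
  by (rule second_derivative_symmetric[OF open_S _ \<psi>])

lemma pullback_has_derivative:
  assumes "x \<in> S"
  shows "((\<lambda>y. H (\<psi> y) (A y v) (A y w)) has_derivative
    (\<lambda>h. cod.DG (\<psi> x) (A x h) (A x v) (A x w) + H (\<psi> x) (D2 x h v) (A x w) + H (\<psi> x) (A x v) (D2 x h w))) (at x)"
proof -
  have 1: "((\<lambda>y. H (\<psi> y) v w) has_derivative (\<lambda>h. cod.DG (\<psi> x) (A x h) v w)) (at x)" for v w
    using has_derivative_compose[OF psi_has_derivative[OF assms] cod.G_has_derivative[OF maps[OF assms]]] .
  have 2: "((\<lambda>y. H (\<psi> y) (A y v) w) has_derivative
      (\<lambda>h. cod.DG (\<psi> x) (A x h) (A x v) w + H (\<psi> x) (D2 x h v) w)) (at x)" for w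
    by (rule linear_family_has_derivative[OF open_S assms cod.lin_left[OF maps] 1 A_has_derivative[OF assms]])
  from linear_family_has_derivative[OF open_S assms cod.lin_right[OF maps] this A_has_derivative[OF assms]]
  show ?thesis .
qed

lemma DG_pullback:
  assumes "x \<in> S"
  shows "dom.DG x h v w =
    cod.DG (\<psi> x) (A x h) (A x v) (A x w) + H (\<psi> x) (D2 x h v) (A x w) + H (\<psi> x) (A x v) (D2 x h w)"
proof -
  have "((\<lambda>y. G y v w) has_derivative
    (\<lambda>h. cod.DG (\<psi> x) (A x h) (A x v) (A x w) + H (\<psi> x) (D2 x h v) (A x w) + H (\<psi> x) (A x v) (D2 x h w))) (at x)"
    by (rule has_derivative_transform_within_open[OF pullback_has_derivative[OF assms] open_S assms])
       (simp add: isometric)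
  from D_eqI[OF this] show ?thesis by simp
qed

text \<open>
  The second derivatives of \<open>\<psi>\<close> enter the Koszul formula in six places, and all but the two equal ones
  cancel by symmetry.
\<close>

lemma christoffel_transform:
  assumes x: "x \<in> S"
  shows "A x (dom.\<Gamma> x v w) = cod.\<Gamma> (\<psi> x) (A x v) (A x w) + D2 x v w"
proof -
  obtain V where V: "cod.\<Gamma> (\<psi> x) (A x v) (A x w) + D2 x v w = A x V"
    by (rule A_surj[OF x])
  have "dom.\<Gamma> x v w = V"
  proof (rule dom.christoffel_eqI[OF x])
    fix z
    have "G x V z = H (\<psi> x) (cod.\<Gamma> (\<psi> x) (A x v) (A x w)) (A x z) + H (\<psi> x) (D2 x v w) (A x z)"
      by (simp add: isometric[OF x] V[symmetric] cod.ladd maps x)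
    then show "2 * G x V z = dom.DG x v w z + dom.DG x w v z - dom.DG x z v w"
      using cod.christoffel_works[OF maps[OF x], of "A x v" "A x w" "A x z"]
      by (simp add: DG_pullback[OF x] D2_sym[OF x, of w v] D2_sym[OF x, of z v] D2_sym[OF x, of z w]
          cod.sym[OF maps[OF x], of "A x v"] cod.sym[OF maps[OF x], of "A x w"])
  qed
  then show ?thesis using V by simp
qed

text \<open>
  Differentiate the transformation rule of the Christoffel symbols. The sum in parentheses, which
  measures the failure to be a tensor, is symmetric in \<open>u\<close> and \<open>v\<close>, and this is why
  the curvature is a tensor.
\<close>

lemma nabla_christoffel_transform:
  assumes x: "x \<in> S"
  shows "A x (nabla_christoffel G x u v w) = nabla_christoffel H (\<psi> x) (A x u) (A x v) (A x w)
    + (cod.\<Gamma> (\<psi> x) (D2 x u v) (A x w) + cod.\<Gamma> (\<psi> x) (A x v) (D2 x u w) + cod.\<Gamma> (\<psi> x) (A x u) (D2 x v w)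
      + D (\<lambda>y. D2 y v w) x u)"
proof -
  let ?y = "\<psi> x"
  have y: "?y \<in> T" using maps x .
  have lhs: "((\<lambda>y. A y (dom.\<Gamma> y v w)) has_derivative
     (\<lambda>h. D2 x h (dom.\<Gamma> x v w) + A x (D (\<lambda>y. dom.\<Gamma> y v w) x h))) (at x)"
    by (rule linear_family_has_derivative[OF open_S x A_linear A_has_derivative[OF x] dom.christoffel_has_derivative[OF x]])
  have 1: "((\<lambda>y. cod.\<Gamma> (\<psi> y) v w) has_derivative (\<lambda>h. D (\<lambda>y. cod.\<Gamma> y v w) ?y (A x h))) (at x)" for v w
    using has_derivative_compose[OF psi_has_derivative[OF x] cod.christoffel_has_derivative[OF y]] .
  have 2: "((\<lambda>y. cod.\<Gamma> (\<psi> y) (A y v) w) has_derivative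
      (\<lambda>h. D (\<lambda>y. cod.\<Gamma> y (A x v) w) ?y (A x h) + cod.\<Gamma> ?y (D2 x h v) w)) (at x)" for w
    by (rule linear_family_has_derivative[OF open_S x cod.christoffel_linear_left[OF maps] 1 A_has_derivative[OF x]])
  have 3: "((\<lambda>y. cod.\<Gamma> (\<psi> y) (A y v) (A y w)) has_derivative
      (\<lambda>h. D (\<lambda>y. cod.\<Gamma> y (A x v) (A x w)) ?y (A x h) + cod.\<Gamma> ?y (D2 x h v) (A x w)
          + cod.\<Gamma> ?y (A x v) (D2 x h w))) (at x)"
    by (rule linear_family_has_derivative[OF open_S x cod.christoffel_linear_right[OF maps] 2 A_has_derivative[OF x]])
  have 4: "((\<lambda>y. D2 y v w) has_derivative (\<lambda>h. D (\<lambda>y. D2 y v w) x h)) (at x)"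
    by (rule smooth_on_has_derivative[OF smooth_on_D[OF smooth_on_D[OF \<psi>]] x])
  have "((\<lambda>y. A y (dom.\<Gamma> y v w)) has_derivative
     (\<lambda>h. D (\<lambda>y. cod.\<Gamma> y (A x v) (A x w)) ?y (A x h) + cod.\<Gamma> ?y (D2 x h v) (A x w)
          + cod.\<Gamma> ?y (A x v) (D2 x h w) + D (\<lambda>y. D2 y v w) x h)) (at x)"
    by (rule has_derivative_transform_within_open[OF has_derivative_add[OF 3 4] open_S x])
       (simp add: christoffel_transform)
  from fun_cong[OF has_derivative_unique[OF lhs this], of u]
  show ?thesis
    unfolding dom.nabla_christoffel_eq cod.nabla_christoffel_eq
    by (simp add: linear_add[OF A_linear[OF x]] christoffel_transform[OF x]
        linear_add[OF cod.christoffel_linear_right[OF y]] algebra_simps)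
qed

lemma riemann_transform:
  assumes x: "x \<in> S"
  shows "A x (riemann G x u v w) = riemann H (\<psi> x) (A x u) (A x v) (A x w)"
proof -
  have "D (\<lambda>y. D2 y v w) x u = D (\<lambda>y. D2 y u w) x v"
    by (rule second_derivative_symmetric[OF open_S x smooth_on_D[OF \<psi>]])
  then show ?thesis
    by (simp add: riemann_eq linear_diff[OF A_linear[OF x]] nabla_christoffel_transform[OF x] D2_sym[OF x, of v u])
qed

lemma ricci_transform:
  assumes x: "x \<in> S"
  shows "ricci G x v w = ricci H (\<psi> x) (A x v) (A x w)"
  unfolding ricci_def
  by (rule endo_trace_conjugate[OF A_linear[OF x] A_inj[OF x]])
     (simp_all add: riemann_transform x cod.riemann_linear maps)

lemma sharp_transform:
  assumes x: "x \<in> S" and "linear \<beta>" "\<And>w. \<alpha> w = \<beta> (A x w)"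
  shows "A x (sharp (G x) \<alpha>) = sharp (H (\<psi> x)) \<beta>"
proof -
  obtain V where V: "sharp (H (\<psi> x)) \<beta> = A x V"
    by (rule A_surj[OF x])
  have "sharp (G x) \<alpha> = V"
    by (rule dom.sharp_eqI[OF x]) (simp add: isometric x V[symmetric] cod.sharp_works maps assms)
  then show ?thesis using V by simp
qed

lemma scalar_curvature_transform:
  assumes x: "x \<in> S"
  shows "scalar_curvature G x = scalar_curvature H (\<psi> x)"
  unfolding scalar_curvature_def
  by (rule endo_trace_conjugate[OF A_linear[OF x] A_inj[OF x]])
     (auto intro!: sharp_transform simp: x maps ricci_transform cod.ricci_linear cod.ricci_sharp_linear)

context
  fixes V U :: "'e \<Rightarrow> real" assumes V: "smooth_on T V" and U: "\<And>x. x \<in> S \<Longrightarrow> U x = V (\<psi> x)"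
begin

lemma deriv_transform:
  assumes x: "x \<in> S"
  shows "D U x v = D V (\<psi> x) (A x v)"
proof -
  have "(U has_derivative (\<lambda>v. D V (\<psi> x) (A x v))) (at x)"
    by (rule has_derivative_transform_within_open[OF has_derivative_compose[OF psi_has_derivative[OF x]
            smooth_on_has_derivative[OF V maps[OF x]]] open_S x])
       (simp add: U)
  from D_eqI[OF this] show ?thesis by simp
qed

text \<open>
  The second derivative of \<open>\<psi>\<close> produced by the chain rule is the one that the Christoffel symbols pick up.
\<close>

lemma local_hess_transform:
  assumes x: "x \<in> S"
  shows "local_hess G U x a b = local_hess H V (\<psi> x) (A x a) (A x b)"
proof -
  have 1: "((\<lambda>y. D V (\<psi> y) w) has_derivative (\<lambda>h. D (\<lambda>z. D V z w) (\<psi> x) (A x h))) (at x)" for w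
    using has_derivative_compose[OF psi_has_derivative[OF x] smooth_on_has_derivative[OF smooth_on_D[OF V] maps[OF x]]] .
  have "((\<lambda>y. D U y b) has_derivative
     (\<lambda>h. D (\<lambda>z. D V z (A x b)) (\<psi> x) (A x h) + D V (\<psi> x) (D2 x h b))) (at x)"
    by (rule has_derivative_transform_within_open[OF linear_family_has_derivative[OF open_S x
            cod.deriv_linear[OF V maps] 1 A_has_derivative[OF x]] open_S x])
       (simp_all add: deriv_transform)
  from D_eqI[OF this] show ?thesis
    unfolding local_hess_def
    by (simp add: deriv_transform x christoffel_transform linear_add[OF cod.deriv_linear[OF V maps]])
qed

lemma local_laplacian_transform:
  assumes x: "x \<in> S"
  shows "local_laplacian G U x = local_laplacian H V (\<psi> x)"
proof -
  have U': "smooth_on S U"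
    using smooth_on_compose[OF open_S V \<psi> maps] smooth_on_cong[OF open_S, of U] U by force
  show ?thesis
    unfolding dom.local_laplacian_eq[OF U' x] cod.local_laplacian_eq[OF V maps[OF x]]
    by (intro endo_trace_conjugate[OF A_linear[OF x] A_inj[OF x]])
       (auto intro!: sharp_transform cod.local_hess_linear cod.hess_sharp_linear V simp: x maps local_hess_transform)
qed

end

end

section \<open>Warped products in coordinates\<close>

lemma has_derivative_comp_fst:
  "(f has_derivative f') (at x) \<Longrightarrow> ((\<lambda>z. f (fst z)) has_derivative (\<lambda>h. f' (fst h))) (at (x, y))"
  by (rule has_derivative_compose[where f = fst and x = "(x, y)", simplified])
     (auto intro: bounded_linear_imp_has_derivative bounded_linear_fst)

lemma has_derivative_comp_snd:
  "(f has_derivative f') (at y) \<Longrightarrow> ((\<lambda>z. f (snd z)) has_derivative (\<lambda>h. f' (snd h))) (at (x, y))"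
  by (rule has_derivative_compose[where f = snd and x = "(x, y)", simplified])
     (auto intro: bounded_linear_imp_has_derivative bounded_linear_snd)

lemma smooth_on_comp_fst:
  fixes f :: "'a::euclidean_space \<Rightarrow> 'c::real_normed_vector"
  assumes "smooth_on S f" "open S" "open (T :: 'b::euclidean_space set)"
  shows "smooth_on (S \<times> T) (\<lambda>z. f (fst z))"
  by (rule smooth_on_compose[OF _ assms(1)]) (auto intro: open_Times assms smooth_on_linear bounded_linear_fst)

lemma smooth_on_comp_snd:
  fixes f :: "'b::euclidean_space \<Rightarrow> 'c::real_normed_vector"
  assumes "smooth_on T f" "open (S :: 'a::euclidean_space set)" "open T"
  shows "smooth_on (S \<times> T) (\<lambda>z. f (snd z))"
  by (rule smooth_on_compose[OF _ assms(1)]) (auto intro: open_Times assms smooth_on_linear bounded_linear_snd)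

lemma endo_trace_prod:
  fixes L :: "'a::euclidean_space \<times> 'b::euclidean_space \<Rightarrow> 'a \<times> 'b"
  shows "endo_trace L = endo_trace (\<lambda>u. fst (L (u, 0))) + endo_trace (\<lambda>u. snd (L (0, u)))"
proof -
  have inj: "inj_on (\<lambda>i. (i, 0)) Basis" "inj_on (\<lambda>i. (0, i)) Basis" by (auto intro: inj_onI)
  have disj: "(\<lambda>i. (i, 0)) ` Basis \<inter> (\<lambda>i. (0, i)) ` Basis = ({} :: ('a \<times> 'b) set)" by auto
  show ?thesis
    unfolding endo_trace_def Basis_prod_def
    by (subst sum.union_disjoint[OF _ _ disj]) (simp_all add: sum.reindex[OF inj(1)] sum.reindex[OF inj(2)] inner_prod_def)
qed

lemma endo_trace_id: "endo_trace (\<lambda>v::'e::euclidean_space. v) = real DIM('e)"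
  by (simp add: endo_trace_def)

lemma endo_trace_rank_one:
  assumes "linear \<alpha>" shows "endo_trace (\<lambda>u. \<alpha> u *\<^sub>R v) = \<alpha> v"
  unfolding endo_trace_def linear_expand[OF assms, of v] by (simp add: mult.commute)

definition warped_form ::
  "('a::euclidean_space \<Rightarrow> 'a \<Rightarrow> 'a \<Rightarrow> real) \<Rightarrow> ('a \<Rightarrow> real) \<Rightarrow> ('b::euclidean_space \<Rightarrow> 'b \<Rightarrow> 'b \<Rightarrow> real) \<Rightarrow>
     'a \<times> 'b \<Rightarrow> 'a \<times> 'b \<Rightarrow> 'a \<times> 'b \<Rightarrow> real" where
  "warped_form GB \<phi> GF z v w =
     GB (fst z) (fst v) (fst w) + (\<phi> (fst z))\<^sup>2 * GF (snd z) (snd v) (snd w)"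

locale local_warped_product = B: metric_on S GB + F: metric_on T GF
  for S :: "'a::euclidean_space set" and GB and T :: "'b::euclidean_space set" and GF +
  fixes \<phi> :: "'a \<Rightarrow> real"
  assumes \<phi>: "smooth_on S \<phi>" and \<phi>_pos: "x \<in> S \<Longrightarrow> \<phi> x > 0"
begin

abbreviation "G \<equiv> warped_form GB \<phi> GF"
abbreviation "p \<equiv> local_grad GB \<phi>"

lemma open_ST: "open (S \<times> T)" by (intro open_Times B.open_S F.open_S)

lemma inner_form_warped:
  assumes "z \<in> S \<times> T" shows "inner_form (G z)"
proof -
  have x: "fst z \<in> S" and y: "snd z \<in> T" using assms by auto
  show ?thesis
  proof
    show "bilinear (G z)"
      unfolding bilinear_def warped_form_def
      by (auto intro!: linearI simp: B.ladd[OF x] B.radd[OF x] B.lmul[OF x] B.rmul[OF x]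
          F.ladd[OF y] F.radd[OF y] F.lmul[OF y] F.rmul[OF y] algebra_simps)
    show "G z v w = G z w v" for v w
      unfolding warped_form_def using B.sym[OF x] F.sym[OF y] by metis
    show "G z v v > 0" if "v \<noteq> 0" for v
    proof -
      have B0: "GB (fst z) a a \<ge> 0" for a
        using inner_form.pos[OF B.inner_form[OF x], of a] linear_0[OF B.lin_left[OF x]] by (cases "a = 0") auto
      have F0: "GF (snd z) a a \<ge> 0" for a
        using inner_form.pos[OF F.inner_form[OF y], of a] linear_0[OF F.lin_left[OF y]] by (cases "a = 0") auto
      show ?thesis
      proof (cases "fst v = 0")
        case True
        then have "snd v \<noteq> 0" using that by (simp add: prod_eq_iff)
        then show ?thesis
          unfolding warped_form_def using inner_form.pos[OF F.inner_form[OF y]] \<phi>_pos[OF x]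
          by (intro add_nonneg_pos B0 mult_pos_pos) auto
      next
        case False
        then show ?thesis
          unfolding warped_form_def using inner_form.pos[OF B.inner_form[OF x]]
          by (intro add_pos_nonneg mult_nonneg_nonneg F0) auto
      qed
    qed
  qed
qed

sublocale metric_on "S \<times> T" G
proof (rule metric_on.intro)
  show "smooth_on (S \<times> T) (\<lambda>z. G z v w)" for v w
    unfolding warped_form_def power2_eq_square
    by (intro smooth_on_add smooth_on_mult open_ST smooth_on_comp_fst[of S] smooth_on_comp_snd[of T]
        B.smooth F.smooth \<phi> B.open_S F.open_S)
qed (rule open_ST, rule inner_form_warped)

context
  fixes x y assumes x: "x \<in> S" and y: "y \<in> T"
begin

lemma point_in: "(x, y) \<in> S \<times> T" using x y by simp

lemma \<phi>_nonzero: "\<phi> x \<noteq> 0" using \<phi>_pos[OF x] by simp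

lemma DG_warped:
  "DG (x, y) u v w = B.DG x (fst u) (fst v) (fst w) + 2 * \<phi> x * D \<phi> x (fst u) * GF y (snd v) (snd w)
     + (\<phi> x)\<^sup>2 * F.DG y (snd u) (snd v) (snd w)"
proof -
  have "((\<lambda>z. G z v w) has_derivative (\<lambda>u. B.DG x (fst u) (fst v) (fst w)
     + (\<phi> (fst (x, y)) * \<phi> (fst (x, y)) * F.DG y (snd u) (snd v) (snd w)
        + (\<phi> (fst (x, y)) * D \<phi> x (fst u) + D \<phi> x (fst u) * \<phi> (fst (x, y))) * GF (snd (x, y)) (snd v) (snd w)))) (at (x, y))"
    unfolding warped_form_def power2_eq_square
    by (intro has_derivative_add has_derivative_mult has_derivative_comp_fst has_derivative_comp_snd
        B.G_has_derivative F.G_has_derivative smooth_on_has_derivative[OF \<phi>] x y)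
  from D_eqI[OF this] show ?thesis by (simp add: power2_eq_square algebra_simps)
qed

text \<open>
  The classical connection of a warped product: \<open>\<nabla>\<^sub>X V = \<nabla>\<^sub>V X = (X \<phi> / \<phi>) V\<close> for \<open>X\<close> horizontal
  and \<open>V\<close> vertical, and the horizontal part of \<open>\<nabla>\<^sub>V W\<close> is \<open>- \<phi> g\<^sub>F(V, W) grad \<phi>\<close>. Since a vector is determined by its
  inner products, it is enough to compare them with the Koszul formula.
\<close>

lemma christoffel_warped:
  "\<Gamma> (x, y) v w = 
    (B.\<Gamma> x (fst v) (fst w) - (\<phi> x * GF y (snd v) (snd w)) *\<^sub>R p x,
     F.\<Gamma> y (snd v) (snd w) + (D \<phi> x (fst v) / \<phi> x) *\<^sub>R snd w + (D \<phi> x (fst w) / \<phi> x) *\<^sub>R snd v)"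
proof (rule christoffel_eqI[OF point_in])
  fix c
  let ?V = "(B.\<Gamma> x (fst v) (fst w) - (\<phi> x * GF y (snd v) (snd w)) *\<^sub>R p x,
     F.\<Gamma> y (snd v) (snd w) + (D \<phi> x (fst v) / \<phi> x) *\<^sub>R snd w + (D \<phi> x (fst w) / \<phi> x) *\<^sub>R snd v)"
  have "2 * G (x, y) ?V c = 2 * GB x (B.\<Gamma> x (fst v) (fst w)) (fst c)
      - 2 * \<phi> x * GF y (snd v) (snd w) * D \<phi> x (fst c)
      + (\<phi> x)\<^sup>2 * (2 * GF y (F.\<Gamma> y (snd v) (snd w)) (snd c))
      + 2 * \<phi> x * D \<phi> x (fst v) * GF y (snd w) (snd c) + 2 * \<phi> x * D \<phi> x (fst w) * GF y (snd v) (snd c)"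
    using \<phi>_nonzero
    by (simp add: warped_form_def B.lsub B.lmul F.ladd F.lmul x y B.G_local_grad[OF \<phi>] power2_eq_square field_simps)
  then show "2 * G (x, y) ?V c = DG (x, y) v w c + DG (x, y) w v c - DG (x, y) c v w"
    unfolding DG_warped B.christoffel_works[OF x] F.christoffel_works[OF y]
    by (simp add: F.sym[OF y, of "snd w" "snd v"] algebra_simps)
qed

text \<open>
  The covariant derivative of the preceding formula. The coefficient of \<open>p x\<close> is symmetric in
  \<open>u\<close> and \<open>v\<close>, once the derivative of the fibre metric is expressed by its Christoffel symbols.
\<close>

lemma nabla_christoffel_warped:
  "nabla_christoffel G (x, y) u v w =
    (nabla_christoffel GB x (fst u) (fst v) (fst w)
       - (\<phi> x * GF y (snd v) (snd w)) *\<^sub>R covariant_deriv GB p x (fst u)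
       - (D \<phi> x (fst u) * GF y (snd v) (snd w) + D \<phi> x (fst v) * GF y (snd u) (snd w) 
          + D \<phi> x (fst w) * GF y (snd u) (snd v)
          + \<phi> x * (F.DG y (snd u) (snd v) (snd w) + GF y (snd u) (F.\<Gamma> y (snd v) (snd w)))) *\<^sub>R p x,
     nabla_christoffel GF y (snd u) (snd v) (snd w)
       + (D (\<lambda>x. D \<phi> x (fst v)) x (fst u) / \<phi> x) *\<^sub>R snd w
       + (D (\<lambda>x. D \<phi> x (fst w)) x (fst u) / \<phi> x) *\<^sub>R snd v
       + (D \<phi> x (fst v) / \<phi> x) *\<^sub>R F.\<Gamma> y (snd u) (snd w)
       + (D \<phi> x (fst w) / \<phi> x) *\<^sub>R F.\<Gamma> y (snd u) (snd v)
       + (D \<phi> x (fst u) / \<phi> x) *\<^sub>R F.\<Gamma> y (snd v) (snd w)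
       + (D \<phi> x (B.\<Gamma> x (fst v) (fst w)) / \<phi> x - D \<phi> x (p x) * GF y (snd v) (snd w)) *\<^sub>R snd u)"
proof -
  have d\<phi>: "(\<phi> has_derivative D \<phi> x) (at x)" by (rule smooth_on_has_derivative[OF \<phi> x])
  have dd\<phi>: "((\<lambda>x. D \<phi> x a) has_derivative D (\<lambda>x. D \<phi> x a) x) (at x)" for a
    by (rule smooth_on_has_derivative[OF smooth_on_D[OF \<phi>] x])
  have 1: "((\<lambda>z. B.\<Gamma> (fst z) (fst v) (fst w) - (\<phi> (fst z) * GF (snd z) (snd v) (snd w)) *\<^sub>R p (fst z)) has_derivative
     (\<lambda>h. D (\<lambda>x. B.\<Gamma> x (fst v) (fst w)) x (fst h) -
        ((\<phi> (fst (x, y)) * GF (snd (x, y)) (snd v) (snd w)) *\<^sub>R D p x (fst h)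
         + (\<phi> (fst (x, y)) * F.DG y (snd h) (snd v) (snd w) + D \<phi> x (fst h) * GF (snd (x, y)) (snd v) (snd w)) *\<^sub>R p (fst (x, y)))))
     (at (x, y))"
    by (intro has_derivative_diff has_derivative_scaleR has_derivative_mult has_derivative_comp_fst has_derivative_comp_snd
       B.christoffel_has_derivative F.G_has_derivative B.local_grad_has_derivative d\<phi> \<phi> x y)
  have 2: "((\<lambda>z. D \<phi> (fst z) a / \<phi> (fst z)) has_derivative
     (\<lambda>h. (D (\<lambda>x. D \<phi> x a) x (fst h) * \<phi> (fst (x, y)) - D \<phi> (fst (x, y)) a * D \<phi> x (fst h)) / (\<phi> (fst (x, y)) * \<phi> (fst (x, y)))))
     (at (x, y))" for a
    using \<phi>_nonzero by (intro has_derivative_divide' has_derivative_comp_fst d\<phi> dd\<phi>) auto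
  have 3: "((\<lambda>z. F.\<Gamma> (snd z) (snd v) (snd w) + (D \<phi> (fst z) (fst v) / \<phi> (fst z)) *\<^sub>R snd w
        + (D \<phi> (fst z) (fst w) / \<phi> (fst z)) *\<^sub>R snd v) has_derivative
     (\<lambda>h. D (\<lambda>y. F.\<Gamma> y (snd v) (snd w)) y (snd h)
       + ((D (\<lambda>x. D \<phi> x (fst v)) x (fst h) * \<phi> x - D \<phi> x (fst v) * D \<phi> x (fst h)) / (\<phi> x * \<phi> x)) *\<^sub>R snd w
       + ((D (\<lambda>x. D \<phi> x (fst w)) x (fst h) * \<phi> x - D \<phi> x (fst w) * D \<phi> x (fst h)) / (\<phi> x * \<phi> x)) *\<^sub>R snd v))
     (at (x, y))"
    by (intro has_derivative_add has_derivative_scaleR_left 2[simplified] has_derivative_comp_snd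
        F.christoffel_has_derivative y)
  have "((\<lambda>z. \<Gamma> z v w) has_derivative (\<lambda>h. 
      (D (\<lambda>x. B.\<Gamma> x (fst v) (fst w)) x (fst h) -
        ((\<phi> x * GF y (snd v) (snd w)) *\<^sub>R D p x (fst h)
         + (\<phi> x * F.DG y (snd h) (snd v) (snd w) + D \<phi> x (fst h) * GF y (snd v) (snd w)) *\<^sub>R p x),
       D (\<lambda>y. F.\<Gamma> y (snd v) (snd w)) y (snd h)
       + ((D (\<lambda>x. D \<phi> x (fst v)) x (fst h) * \<phi> x - D \<phi> x (fst v) * D \<phi> x (fst h)) / (\<phi> x * \<phi> x)) *\<^sub>R snd w
       + ((D (\<lambda>x. D \<phi> x (fst w)) x (fst h) * \<phi> x - D \<phi> x (fst w) * D \<phi> x (fst h)) / (\<phi> x * \<phi> x)) *\<^sub>R snd v)))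
     (at (x, y))"
    by (rule has_derivative_transform_within_open[OF has_derivative_Pair[OF 1[simplified] 3] open_ST point_in])
       (auto simp: local_warped_product.christoffel_warped[OF local_warped_product_axioms])
  note deriv = fun_cong[OF D_eqI[OF this], of u]
  show ?thesis
    unfolding nabla_christoffel_eq deriv christoffel_warped B.nabla_christoffel_eq F.nabla_christoffel_eq
      covariant_deriv_def
    using \<phi>_nonzero
    by (simp add: linear_diff[OF B.christoffel_linear_right[OF x]] linear_scale[OF B.christoffel_linear_right[OF x]]
        linear_add[OF F.christoffel_linear_right[OF y]] linear_scale[OF F.christoffel_linear_right[OF y]]
        F.radd[OF y] F.rmul[OF y] linear_diff[OF B.deriv_linear[OF \<phi> x]] linear_scale[OF B.deriv_linear[OF \<phi> x]]
        algebra_simps diff_divide_distrib add_divide_distrib)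
qed

text \<open>
  Antisymmetrize the preceding formula in \<open>u\<close> and \<open>v\<close>. In the vertical component the second derivatives of \<open>\<phi>\<close>
  meet the terms \<open>D \<phi> x (B.\<Gamma> x v w)\<close> of the opposite order and combine to the Hessian of \<open>\<phi>\<close>.
\<close>

lemma riemann_warped:
  "riemann G (x, y) u v w =
    (riemann GB x (fst u) (fst v) (fst w)
       - \<phi> x *\<^sub>R (GF y (snd v) (snd w) *\<^sub>R covariant_deriv GB p x (fst u)
                   - GF y (snd u) (snd w) *\<^sub>R covariant_deriv GB p x (fst v)),
     riemann GF y (snd u) (snd v) (snd w)
       + (local_hess GB \<phi> x (fst u) (fst w) / \<phi> x) *\<^sub>R snd v
       - (local_hess GB \<phi> x (fst v) (fst w) / \<phi> x) *\<^sub>R snd u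
       - D \<phi> x (p x) *\<^sub>R (GF y (snd v) (snd w) *\<^sub>R snd u - GF y (snd u) (snd w) *\<^sub>R snd v))"
proof -
  have s1: "D (\<lambda>x. D \<phi> x (fst v)) x (fst u) = D (\<lambda>x. D \<phi> x (fst u)) x (fst v)"
    by (rule second_derivative_symmetric[OF B.open_S x \<phi>])
  show ?thesis
    unfolding riemann_eq nabla_christoffel_warped F.metric_compatible[OF y] local_hess_def s1
      F.christoffel_sym[OF y, of "snd v" "snd u"] F.sym[OF y, of "snd v" "snd u"]
      F.sym[OF y, of "snd v" "F.\<Gamma> y (snd u) (snd w)"]
    by (simp add: algebra_simps diff_divide_distrib add_divide_distrib F.sym[OF y])
qed

text \<open>
  Horizontal directions contribute the Ricci form of the base and the Laplacian of \<open>\<phi>\<close> to the trace; vertical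
  directions contribute the Ricci form of the fibre, the Hessian of \<open>\<phi>\<close> once for every dimension, and the term with
  \<open>DIM('b) - 1\<close>, which is the trace of the identity minus that of a rank one map.
\<close>

lemma ricci_warped:
  "ricci G (x, y) v w =
     ricci GB x (fst v) (fst w) - real DIM('b) / \<phi> x * local_hess GB \<phi> x (fst v) (fst w)
     + ricci GF y (snd v) (snd w)
     - (\<phi> x * local_laplacian GB \<phi> x + (real DIM('b) - 1) * D \<phi> x (p x)) * GF y (snd v) (snd w)"
proof -
  have 1: "endo_trace (\<lambda>u. fst (riemann G (x, y) (u, 0) v w)) =
     ricci GB x (fst v) (fst w) - \<phi> x * GF y (snd v) (snd w) * local_laplacian GB \<phi> x"
    unfolding riemann_warped
    by (simp add: linear_0[OF F.lin_left[OF y]] ricci_def local_laplacian_def endo_trace_diff endo_trace_scaleR)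
  have 2: "endo_trace (\<lambda>u. snd (riemann G (x, y) (0, u) v w)) =
     ricci GF y (snd v) (snd w) - real DIM('b) / \<phi> x * local_hess GB \<phi> x (fst v) (fst w)
     - (real DIM('b) - 1) * D \<phi> x (p x) * GF y (snd v) (snd w)"
    unfolding riemann_warped
    by (simp add: linear_0[OF B.local_hess_linear(1)[OF \<phi> x]] ricci_def endo_trace_diff endo_trace_scaleR
        endo_trace_id endo_trace_rank_one[OF F.lin_left[OF y]] endo_trace_add, simp add: algebra_simps)
  show ?thesis
    unfolding ricci_def[of G] endo_trace_prod[of "\<lambda>u. riemann G (x, y) u v w"] 1 2 by (simp add: algebra_simps)
qed

lemma sharp_warped:
  assumes "linear \<alpha>" "linear \<beta>" "\<And>w. \<gamma> w = \<alpha> (fst w) + \<beta> (snd w)"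
  shows "sharp (G (x, y)) \<gamma> = (sharp (GB x) \<alpha>, (1 / (\<phi> x)\<^sup>2) *\<^sub>R sharp (GF y) \<beta>)"
  using \<phi>_nonzero
  by (intro sharp_eqI[OF point_in]) (simp add: warped_form_def assms F.lmul y B.sharp_works F.sharp_works x)

text \<open>
  \<open>D \<phi> x (p x)\<close> is the squared norm of the gradient of \<open>\<phi>\<close>. The horizontal and the vertical
  block of the Ricci form each contribute half of the term with the Laplacian.
\<close>

lemma scalar_curvature_warped:
  "scalar_curvature G (x, y) = scalar_curvature GB x
     + (scalar_curvature GF y - 2 * real DIM('b) * \<phi> x * local_laplacian GB \<phi> x
        - real DIM('b) * (real DIM('b) - 1) * D \<phi> x (p x)) / (\<phi> x)\<^sup>2"
proof -
  let ?m = "real DIM('b)"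
  let ?k = "\<phi> x * local_laplacian GB \<phi> x + (?m - 1) * D \<phi> x (p x)"
  have B0: "ricci GB x 0 w = 0" "local_hess GB \<phi> x 0 w = 0" for w
    using linear_0[OF B.ricci_linear(1)[OF x]] linear_0[OF B.local_hess_linear(1)[OF \<phi> x]] by auto
  have F0: "ricci GF y 0 w = 0" "GF y 0 w = 0" for w
    using linear_0[OF F.ricci_linear(1)[OF y]] linear_0[OF F.lin_left[OF y]] by auto
  have lin: "linear (\<lambda>w. ricci GB x v w - ?m / \<phi> x * local_hess GB \<phi> x v w)"
     "linear (\<lambda>w. ricci GF y v' w - ?k * GF y v' w)" for v v'
    by (rule linearI; simp add: linear_add[OF B.ricci_linear(2)[OF x]] linear_scale[OF B.ricci_linear(2)[OF x]]
       linear_add[OF B.local_hess_linear(2)[OF \<phi> x]] linear_scale[OF B.local_hess_linear(2)[OF \<phi> x]]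
       linear_add[OF F.ricci_linear(2)[OF y]] linear_scale[OF F.ricci_linear(2)[OF y]]
       F.radd[OF y] F.rmul[OF y] algebra_simps)+
  have 1: "fst (sharp (G (x, y)) (ricci G (x, y) (v, 0))) =
      sharp (GB x) (ricci GB x v) - (?m / \<phi> x) *\<^sub>R sharp (GB x) (local_hess GB \<phi> x v)" for v
  proof -
    have "sharp (GB x) (\<lambda>w. ricci GB x v w - ?m / \<phi> x * local_hess GB \<phi> x v w) =
       sharp (GB x) (ricci GB x v) - (?m / \<phi> x) *\<^sub>R sharp (GB x) (local_hess GB \<phi> x v)"
      by (rule B.sharp_eqI[OF x])
         (simp add: B.lsub[OF x] B.lmul[OF x] B.sharp_works[OF x] B.ricci_linear[OF x] B.local_hess_linear[OF \<phi> x])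
    then show ?thesis
      by (subst sharp_warped[OF lin(1)[of v] lin(2)[of 0]]) (simp_all add: ricci_warped F0)
  qed
  have 2: "snd (sharp (G (x, y)) (ricci G (x, y) (0, v))) =
      (1 / (\<phi> x)\<^sup>2) *\<^sub>R (sharp (GF y) (ricci GF y v) - ?k *\<^sub>R v)" for v
  proof -
    have "sharp (GF y) (\<lambda>w. ricci GF y v w - ?k * GF y v w) = sharp (GF y) (ricci GF y v) - ?k *\<^sub>R v"
      by (rule F.sharp_eqI[OF y]) (simp add: F.lsub[OF y] F.lmul[OF y] F.sharp_works[OF y] F.ricci_linear[OF y])
    then show ?thesis
      by (subst sharp_warped[OF lin(1)[of 0] lin(2)[of v]]) (simp_all add: ricci_warped B0)
  qed
  have "scalar_curvature G (x, y) = (scalar_curvature GB x - ?m / \<phi> x * local_laplacian GB \<phi> x)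
     + (1 / (\<phi> x)\<^sup>2) * (scalar_curvature GF y - ?k * ?m)"
    unfolding scalar_curvature_def[of G] endo_trace_prod[of "\<lambda>v. sharp (G (x, y)) (ricci G (x, y) v)"] 1 2
      endo_trace_diff endo_trace_scaleR endo_trace_id
    by (simp add: scalar_curvature_def B.local_laplacian_eq[OF \<phi> x])
  moreover have "?m / \<phi> x * local_laplacian GB \<phi> x = ?m * \<phi> x * local_laplacian GB \<phi> x / (\<phi> x)\<^sup>2"
    using \<phi>_nonzero by (simp add: power2_eq_square)
  ultimately show ?thesis
    by (simp add: add_divide_distrib diff_divide_distrib algebra_simps)
qed

text \<open>
  The second derivatives of a function of the base see only the base, and the fibre term is the vertical-vertical
  Christoffel symbol, whose horizontal part is a multiple of the gradient of \<open>\<phi>\<close>.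
\<close>

lemma local_hess_warped:
  assumes f: "smooth_on S f"
  shows "local_hess G (\<lambda>z. f (fst z)) (x, y) v w =
    local_hess GB f x (fst v) (fst w) + \<phi> x * GF y (snd v) (snd w) * D f x (p x)"
proof -
  have 1: "D (\<lambda>z. f (fst z)) (a, b) u = D f a (fst u)" if "a \<in> S" for a u and b :: 'b
    by (simp add: D_eqI[OF has_derivative_comp_fst[OF smooth_on_has_derivative[OF f that]]])
  have "((\<lambda>z. D (\<lambda>z. f (fst z)) z w) has_derivative (\<lambda>h. D (\<lambda>z. D f z (fst w)) x (fst h))) (at (x, y))"
    by (rule has_derivative_transform_within_open[OF
          has_derivative_comp_fst[OF smooth_on_has_derivative[OF smooth_on_D[OF f] x]] open_ST point_in])
       (auto simp: 1)
  from D_eqI[OF this] show ?thesis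
    unfolding local_hess_def christoffel_warped 1[OF x]
    by (simp add: linear_diff[OF B.deriv_linear[OF f x]] linear_scale[OF B.deriv_linear[OF f x]])
qed

end

end

section \<open>Manifolds in charts\<close>

locale smooth_atlas =
  fixes A :: "('p::{t2_space, second_countable_topology}, 'e::euclidean_space) chart set"
  assumes smooth_manifold: "smooth_manifold A"
begin

lemma
  assumes "c \<in> A"
  shows open_cdom: "open (cdom c)" and open_cimg [simp]: "open (cimg c)"
    and chart_homeomorphism: "homeomorphism (cdom c) (cimg c) (cmap c) (cinv c)"
  using smooth_manifold assms unfolding smooth_manifold_def by blast+

lemma
  assumes "c \<in> A"
  shows cinv_cmap: "p \<in> cdom c \<Longrightarrow> cinv c (cmap c p) = p"
    and cmap_cinv: "x \<in> cimg c \<Longrightarrow> cmap c (cinv c x) = x"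
    and cinv_in: "x \<in> cimg c \<Longrightarrow> cinv c x \<in> cdom c"
    and cmap_in: "p \<in> cdom c \<Longrightarrow> cmap c p \<in> cimg c"
  using chart_homeomorphism[OF assms] unfolding homeomorphism_def by auto

lemma open_chart_image:
  assumes "c \<in> A" "open U" shows "open (cmap c ` (cdom c \<inter> U))"
proof -
  have "cmap c ` (cdom c \<inter> U) = cimg c \<inter> cinv c -` U"
    using cinv_cmap[OF assms(1)] cmap_cinv[OF assms(1)] cinv_in[OF assms(1)] cmap_in[OF assms(1)]
    by (auto simp: image_iff) (metis IntI)
  moreover have "open (cimg c \<inter> cinv c -` U)"
    using chart_homeomorphism[OF assms(1)] open_cimg[OF assms(1)] assms(2)
    by (intro continuous_open_preimage) (auto simp: homeomorphism_def)
  ultimately show ?thesis by simp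
qed

lemma chart_at: "chart_at A p \<in> A" "p \<in> cdom (chart_at A p)"
proof -
  have "\<exists>c. c \<in> A \<and> p \<in> cdom c"
    using smooth_manifold unfolding smooth_manifold_def by blast
  from someI_ex[OF this] show "chart_at A p \<in> A" "p \<in> cdom (chart_at A p)"
    unfolding chart_at_def by auto
qed

abbreviation overlap :: "('p, 'e) chart \<Rightarrow> ('p, 'e) chart \<Rightarrow> 'e set" where
  "overlap c d \<equiv> cmap c ` (cdom c \<inter> cdom d)"

abbreviation transition :: "('p, 'e) chart \<Rightarrow> ('p, 'e) chart \<Rightarrow> 'e \<Rightarrow> 'e" where
  "transition c d \<equiv> cmap d \<circ> cinv c"

lemma open_overlap: "c \<in> A \<Longrightarrow> d \<in> A \<Longrightarrow> open (overlap c d)"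
  by (intro open_chart_image open_cdom)

lemma transition_smooth: "c \<in> A \<Longrightarrow> d \<in> A \<Longrightarrow> smooth_on (overlap c d) (transition c d)"
  using smooth_manifold unfolding smooth_manifold_def by blast

lemma overlap_subset: "c \<in> A \<Longrightarrow> overlap c d \<subseteq> cimg c"
  unfolding cimg_def by auto

lemma transition_in: "c \<in> A \<Longrightarrow> d \<in> A \<Longrightarrow> x \<in> overlap c d \<Longrightarrow> transition c d x \<in> cimg d"
  by (auto simp: cinv_cmap cmap_in)

lemma cinv_transition: "c \<in> A \<Longrightarrow> d \<in> A \<Longrightarrow> x \<in> overlap c d \<Longrightarrow> cinv d (transition c d x) = cinv c x"
  by (auto simp: cinv_cmap)

lemma transition_has_derivative:
  "c \<in> A \<Longrightarrow> d \<in> A \<Longrightarrow> x \<in> overlap c d \<Longrightarrow> (transition c d has_derivative D (transition c d) x) (at x)"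
  by (rule smooth_on_has_derivative[OF transition_smooth])

lemma smooth_fun_iff: "smooth_fun A h \<longleftrightarrow> (\<forall>c\<in>A. smooth_on (cimg c) (h \<circ> cinv c))"
  unfolding smooth_fun_on_def cimg_def by simp

lemma smooth_fun_near: "smooth_fun A h \<Longrightarrow> smooth_near A p h"
  unfolding smooth_near_def by (intro exI[of _ UNIV]) auto

lemma smooth_near_has_derivative:
  assumes "smooth_near A p h" "c \<in> A" "p \<in> cdom c"
  shows "((h \<circ> cinv c) has_derivative D (h \<circ> cinv c) (cmap c p)) (at (cmap c p))"
proof -
  obtain U where "open U" "p \<in> U" "smooth_on (cmap c ` (cdom c \<inter> U)) (h \<circ> cinv c)"
    using assms unfolding smooth_near_def smooth_fun_on_def by blast
  then show ?thesis using assms by (intro smooth_on_has_derivative) auto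
qed

text \<open>
  Makes the coordinates of tangent vectors meaningful: a coordinate function of a chart is smooth on the domain
  of the chart, whatever values it takes elsewhere.
\<close>

lemma coordinate_function_smooth_near:
  assumes "d \<in> A" "p \<in> cdom d" shows "smooth_near A p (\<lambda>q. cmap d q \<bullet> i)"
  unfolding smooth_near_def
proof (intro exI conjI)
  show "smooth_fun_on A (cdom d) (\<lambda>q. cmap d q \<bullet> i)"
    unfolding smooth_fun_on_def
  proof
    fix c assume "c \<in> A"
    then show "smooth_on (overlap c d) ((\<lambda>q. cmap d q \<bullet> i) \<circ> cinv c)"
      using smooth_on_inner_left[OF open_overlap transition_smooth] assms by (simp add: comp_def)
  qed
qed (use assms open_cdom in auto)

text \<open>
  The chain rule for the transition map; so all charts around a point define the same tangent space.
\<close>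

lemma coord_vec_change:
  assumes c: "c \<in> A" "p \<in> cdom c" and d: "d \<in> A" "p \<in> cdom d"
  shows "coord_vec A c p v = coord_vec A d p (D (transition c d) (cmap c p) v)"
proof
  fix h
  show "coord_vec A c p v h = coord_vec A d p (D (transition c d) (cmap c p) v) h"
  proof (cases "smooth_near A p h")
    case True
    have x: "cmap c p \<in> overlap c d" using c d by auto
    have t: "transition c d (cmap c p) = cmap d p" by (simp add: cinv_cmap c)
    have "((\<lambda>x. (h \<circ> cinv d) (transition c d x)) has_derivative
        (\<lambda>v. D (h \<circ> cinv d) (cmap d p) (D (transition c d) (cmap c p) v))) (at (cmap c p))"
      using smooth_near_has_derivative[OF True d]
      by (intro has_derivative_compose[OF transition_has_derivative[OF c(1) d(1) x]]) (simp only: t)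
    then have "((h \<circ> cinv c) has_derivative
        (\<lambda>v. D (h \<circ> cinv d) (cmap d p) (D (transition c d) (cmap c p) v))) (at (cmap c p))"
      by (rule has_derivative_transform_within_open[OF _ open_overlap[OF c(1) d(1)] x])
         (use cinv_transition[OF c(1) d(1)] in simp)
    from D_eqI[OF this] show ?thesis using True by (simp add: coord_vec_def)
  qed (simp add: coord_vec_def)
qed

lemma tangent_space_eq: "c \<in> A \<Longrightarrow> p \<in> cdom c \<Longrightarrow> tangent_space A p = range (coord_vec A c p)"
  unfolding tangent_space_def using coord_vec_change by fast

lemma coords_coord_vec:
  assumes c: "c \<in> A" "p \<in> cdom c" and d: "d \<in> A" "p \<in> cdom d"
  shows "coords d (coord_vec A c p v) = D (transition c d) (cmap c p) v"
proof -
  have x: "cmap c p \<in> overlap c d" using c d by auto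
  have "D ((\<lambda>q. cmap d q \<bullet> i) \<circ> cinv c) (cmap c p) v = D (transition c d) (cmap c p) v \<bullet> i" for i
    using D_eqI[OF has_derivative_inner_left[OF transition_has_derivative[OF c(1) d(1) x], of i]] by (simp add: comp_def)
  then show ?thesis
    unfolding coords_def coord_vec_def
    by (simp add: coordinate_function_smooth_near[OF d] euclidean_representation)
qed

lemma coords_coord_vec_same [simp]:
  assumes "c \<in> A" "p \<in> cdom c"
  shows "coords c (coord_vec A c p v) = v"
proof -
  have "((\<lambda>x. x) has_derivative (\<lambda>v. v)) (at (cmap c p))" by simp
  then have "(transition c c has_derivative (\<lambda>v. v)) (at (cmap c p))"
    by (rule has_derivative_transform_within_open[OF _ open_cimg[OF assms(1)] cmap_in[OF assms]])
       (simp add: cmap_cinv assms)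
  from D_eqI[OF this] show ?thesis using coords_coord_vec[OF assms assms] by simp
qed

lemma coord_vec_inj: "c \<in> A \<Longrightarrow> p \<in> cdom c \<Longrightarrow> coord_vec A c p v = coord_vec A c p w \<Longrightarrow> v = w"
  by (metis coords_coord_vec_same)

lemma differential_coord_vec:
  "smooth_fun A u \<Longrightarrow> differential u (coord_vec A c p v) = D (u \<circ> cinv c) (cmap c p) v"
  unfolding differential_def coord_vec_def by (simp add: smooth_fun_near)

lemma riemannian_metric_iff:
  "riemannian_metric A g \<longleftrightarrow> (\<forall>c\<in>A. metric_on (cimg c) (local_form A g c))"
  unfolding riemannian_metric_def metric_on_def inner_form_def Let_def using open_cimg by blast

end

lemma metric_on_subset:
  assumes "metric_on S G" "open S'" "S' \<subseteq> S" shows "metric_on S' G"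
  using assms smooth_on_subset[OF _ assms(3)] unfolding metric_on_def by blast

text \<open>
  The local form of a metric in a product chart is a warped form on the image of the chart only; the
  identity, regarded as an isometry, carries all the invariants across.
\<close>

lemma metric_on_cong:
  assumes "metric_on S H" "\<And>x v w. x \<in> S \<Longrightarrow> G x v w = H x v w"
  shows "metric_on S G" and "local_isometry S G S H (\<lambda>x. x)"
proof -
  interpret metric_on S H by fact
  have eq: "G x = H x" if "x \<in> S" for x using assms(2)[OF that] by (intro ext)
  show G: "metric_on S G"
  proof (rule metric_on.intro)
    show "smooth_on S (\<lambda>x. G x v w)" for v w
      using smooth smooth_on_cong[OF open_S, of "\<lambda>x. G x v w" "\<lambda>x. H x v w"] assms(2) by simp
  qed (simp_all add: inner_form eq)
  interpret G: metric_on S G by fact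
  show "local_isometry S G S H (\<lambda>x. x)"
    by unfold_locales (auto intro: smooth_on_linear bounded_linear_ident simp: eq)
qed

locale riemannian = smooth_atlas A for A :: "('p::{t2_space, second_countable_topology}, 'e::euclidean_space) chart set" +
  fixes g :: "'p bform"
  assumes metric: "riemannian_metric A g"
begin

lemma riemannian_manifold: "riemannian_manifold A g"
  unfolding riemannian_manifold_def using smooth_manifold metric by simp

lemma metric_on: "c \<in> A \<Longrightarrow> metric_on (cimg c) (local_form A g c)"
  using metric riemannian_metric_iff by blast

text \<open>
  Turns every invariance under local isometries into independence of the chart.
\<close>

lemma chart_change_isometry:
  assumes "c \<in> A" "d \<in> A"
  shows "local_isometry (overlap c d) (local_form A g c) (cimg d) (local_form A g d) (transition c d)"
proof -
  interpret dom: metric_on "overlap c d" "local_form A g c"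
    by (rule metric_on_subset[OF metric_on open_overlap overlap_subset]) (use assms in auto)
  interpret cod: metric_on "cimg d" "local_form A g d"
    by (rule metric_on) (rule assms)
  show ?thesis
  proof
    show "local_form A g c x v w = local_form A g d (transition c d x) (D (transition c d) x v) (D (transition c d) x w)"
      if x: "x \<in> overlap c d" for x v w
    proof -
      have "cinv c x \<in> cdom c" "cinv c x \<in> cdom d" "cmap c (cinv c x) = x"
        using x by (auto simp: cinv_cmap assms)
      then show ?thesis
        unfolding local_form_def cinv_transition[OF assms x]
        using coord_vec_change[OF assms(1) _ assms(2), of "cinv c x"] by simp
    qed
  qed (use transition_smooth[OF assms] transition_in[OF assms] in auto)
qed

lemma g_coord_vec:
  assumes "c \<in> A" "p \<in> cdom c"
  shows "g p (coord_vec A c p v) (coord_vec A c p w) = local_form A g c (cmap c p) v w"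
  unfolding local_form_def using assms by (simp add: cinv_cmap)

lemma scal_chart:
  assumes "c \<in> A" "p \<in> cdom c"
  shows "scal A g p = scalar_curvature (local_form A g c) (cmap c p)"
proof -
  let ?c = "chart_at A p"
  interpret local_isometry "overlap ?c c" "local_form A g ?c" "cimg c" "local_form A g c" "transition ?c c"
    by (rule chart_change_isometry[OF chart_at(1) assms(1)])
  have "cmap ?c p \<in> overlap ?c c" using chart_at assms by auto
  from scalar_curvature_transform[OF this] show ?thesis
    unfolding scal_def Let_def by (simp add: cinv_cmap chart_at)
qed

context
  fixes u assumes u: "smooth_fun A u"
begin

lemma smooth_on_chart: "c \<in> A \<Longrightarrow> smooth_on (cimg c) (u \<circ> cinv c)"
  using u smooth_fun_iff by blast

lemma grad_chart:
  assumes c: "c \<in> A" "p \<in> cdom c"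
  shows "grad A g u p = coord_vec A c p (local_grad (local_form A g c) (u \<circ> cinv c) (cmap c p))"
proof -
  interpret metric_on "cimg c" "local_form A g c" by (rule metric_on[OF c(1)])
  have x: "cmap c p \<in> cimg c" by (rule cmap_in[OF c])
  note G_grad = G_local_grad[OF smooth_on_chart[OF c(1)] x]
  show ?thesis
    unfolding grad_def tangent_space_eq[OF c]
  proof (rule the_equality, intro conjI ballI)
    fix w assume "w \<in> range (coord_vec A c p)"
    then show "g p (coord_vec A c p (local_grad (local_form A g c) (u \<circ> cinv c) (cmap c p))) w = differential u w"
      by (auto simp: g_coord_vec c G_grad differential_coord_vec u)
  next
    fix v assume v: "v \<in> range (coord_vec A c p) \<and> (\<forall>w\<in>range (coord_vec A c p). g p v w = differential u w)"
    then obtain a where a: "v = coord_vec A c p a" by blast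
    have "local_form A g c (cmap c p) a b = D (u \<circ> cinv c) (cmap c p) b" for b
      using v unfolding a by (auto simp: g_coord_vec c differential_coord_vec u)
    from sharp_eqI[OF x this] show "v = coord_vec A c p (local_grad (local_form A g c) (u \<circ> cinv c) (cmap c p))"
      unfolding a local_grad_def by simp
  qed simp
qed

lemma laplacian_chart:
  assumes c: "c \<in> A" "p \<in> cdom c"
  shows "laplacian A g u p = local_laplacian (local_form A g c) (u \<circ> cinv c) (cmap c p)"
proof -
  let ?c = "chart_at A p"
  let ?G = "local_form A g ?c" and ?U = "u \<circ> cinv ?c" and ?x = "cmap ?c p"
  have x: "?x \<in> cimg ?c" by (rule cmap_in[OF chart_at])
  have x': "?x \<in> overlap ?c c" using chart_at c by auto
  have eq: "coords ?c (grad A g u (cinv ?c y)) = local_grad ?G ?U y" if "y \<in> cimg ?c" for y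
    using that by (simp add: grad_chart[OF chart_at(1) cinv_in[OF chart_at(1)]] chart_at(1) cinv_in cmap_cinv)
  have D_eq: "D (\<lambda>y. coords ?c (grad A g u (cinv ?c y))) ?x = D (local_grad ?G ?U) ?x"
    by (rule D_cong[OF open_cimg[OF chart_at(1)] x eq])
  have "laplacian A g u p = local_laplacian ?G ?U ?x"
    unfolding laplacian_def divergence_def Let_def local_laplacian_def covariant_deriv_def
      D_eq eq[OF x] ..
  also have "\<dots> = local_laplacian (local_form A g c) (u \<circ> cinv c) (transition ?c c ?x)"
    using x' cinv_transition[OF chart_at(1) c(1)]
    by (intro local_isometry.local_laplacian_transform[OF chart_change_isometry[OF chart_at(1) c(1)]
          smooth_on_chart[OF c(1)]]) simp_all
  finally show ?thesis by (simp add: cinv_cmap chart_at)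
qed

lemma hess_chart:
  assumes c: "c \<in> A" "p \<in> cdom c"
  shows "hess A g u p (coord_vec A c p a) (coord_vec A c p b) =
    local_hess (local_form A g c) (u \<circ> cinv c) (cmap c p) a b"
proof -
  let ?c = "chart_at A p"
  let ?G = "local_form A g c" and ?U = "u \<circ> cinv c" and ?x = "cmap c p"
  have x: "?x \<in> overlap c ?c" using chart_at c by auto
  have "local_hess ?G ?U ?x a b = local_hess (local_form A g ?c) (u \<circ> cinv ?c) (transition c ?c ?x)
     (D (transition c ?c) ?x a) (D (transition c ?c) ?x b)"
    using cinv_transition[OF c(1) chart_at(1)]
    by (intro local_isometry.local_hess_transform[OF chart_change_isometry[OF c(1) chart_at(1)]
          smooth_on_chart[OF chart_at(1)] _ x]) simp
  then show ?thesis
    unfolding hess_def Let_def coords_coord_vec[OF c chart_at] local_hess_def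
    by (simp add: cinv_cmap c)
qed

lemma laplacian_smooth: "smooth_fun A (laplacian A g u)"
  unfolding smooth_fun_iff
proof
  fix c assume c: "c \<in> A"
  interpret metric_on "cimg c" "local_form A g c" by (rule metric_on[OF c(1)])
  have "(laplacian A g u \<circ> cinv c) x = local_laplacian (local_form A g c) (u \<circ> cinv c) x" if "x \<in> cimg c" for x
    using that by (simp add: laplacian_chart[OF c] cinv_in[OF c] cmap_cinv[OF c])
  then show "smooth_on (cimg c) (laplacian A g u \<circ> cinv c)"
    using smooth_on_cong[OF open_S, of "laplacian A g u \<circ> cinv c"] local_laplacian_smooth[OF smooth_on_chart[OF c]]
    by simp
qed

lemma gnorm_grad_chart:
  assumes c: "c \<in> A" "p \<in> cdom c"
  shows "(gnorm g p (grad A g u p))\<^sup>2 =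
    D (u \<circ> cinv c) (cmap c p) (local_grad (local_form A g c) (u \<circ> cinv c) (cmap c p))"
proof -
  interpret metric_on "cimg c" "local_form A g c" by (rule metric_on[OF c(1)])
  have x: "cmap c p \<in> cimg c" by (rule cmap_in[OF c])
  let ?v = "local_grad (local_form A g c) (u \<circ> cinv c) (cmap c p)"
  have "local_form A g c (cmap c p) ?v ?v \<ge> 0"
    using inner_form.pos[OF inner_form[OF x], of ?v] linear_0[OF lin_left[OF x]] by (cases "?v = 0") auto
  then show ?thesis
    unfolding gnorm_def grad_chart[OF c] g_coord_vec[OF c]
    by (simp add: G_local_grad[OF smooth_on_chart[OF c(1)] x])
qed

lemma gnorm_grad_smooth: "smooth_fun A (\<lambda>p. (gnorm g p (grad A g u p))\<^sup>2)"
  unfolding smooth_fun_iff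
proof
  fix c assume c: "c \<in> A"
  interpret metric_on "cimg c" "local_form A g c" by (rule metric_on[OF c(1)])
  note U = smooth_on_chart[OF c]
  have "((\<lambda>p. (gnorm g p (grad A g u p))\<^sup>2) \<circ> cinv c) x
     = D (u \<circ> cinv c) x (local_grad (local_form A g c) (u \<circ> cinv c) x)" if "x \<in> cimg c" for x
    using that by (simp add: gnorm_grad_chart[OF c] cinv_in[OF c] cmap_cinv[OF c])
  then show "smooth_on (cimg c) ((\<lambda>p. (gnorm g p (grad A g u p))\<^sup>2) \<circ> cinv c)"
    by (rule smooth_on_cong[OF open_S, THEN iffD2])
       (assumption, rule smooth_on_linear_family[OF open_S deriv_linear[OF U] smooth_on_D[OF U] local_grad_smooth[OF U]])
qed

end

text \<open>
  In the definition of a soliton the gradient is given but its potential is existentially quantified. The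
  choice of potential does not matter, because the gradient determines the differential and so the Hessian.
\<close>

lemma same_grad_same_hess:
  assumes u: "smooth_fun A u" "smooth_fun A u'" and grad: "grad A g u = grad A g u'"
    and c: "c \<in> A" "x \<in> cimg c"
  shows "D (u \<circ> cinv c) x = D (u' \<circ> cinv c) x"
    and "local_hess (local_form A g c) (u \<circ> cinv c) x = local_hess (local_form A g c) (u' \<circ> cinv c) x"
proof -
  interpret metric_on "cimg c" "local_form A g c" by (rule metric_on[OF c(1)])
  have D: "D (u \<circ> cinv c) y = D (u' \<circ> cinv c) y" if y: "y \<in> cimg c" for y
  proof
    fix w
    have p: "cinv c y \<in> cdom c" "cmap c (cinv c y) = y" using y c(1) by (simp_all add: cinv_in cmap_cinv)
    have "local_grad (local_form A g c) (u \<circ> cinv c) y = local_grad (local_form A g c) (u' \<circ> cinv c) y"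
      using grad_chart[OF u(1) c(1) p(1)] grad_chart[OF u(2) c(1) p(1)] grad
      by (intro coord_vec_inj[OF c(1) p(1)]) (simp add: p(2))
    then show "D (u \<circ> cinv c) y w = D (u' \<circ> cinv c) y w"
      using G_local_grad[OF smooth_on_chart[OF u(1) c(1)] y, of w] G_local_grad[OF smooth_on_chart[OF u(2) c(1)] y, of w]
      by simp
  qed
  then show "D (u \<circ> cinv c) x = D (u' \<circ> cinv c) x" using c by blast
  have "D (\<lambda>y. D (u \<circ> cinv c) y b) x = D (\<lambda>y. D (u' \<circ> cinv c) y b) x" for b
    by (rule D_cong[OF open_S c(2)]) (simp add: D)
  then show "local_hess (local_form A g c) (u \<circ> cinv c) x = local_hess (local_form A g c) (u' \<circ> cinv c) x"
    unfolding local_hess_def[abs_def] by (simp add: D[OF c(2)])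
qed

definition soliton_equation :: "('p \<Rightarrow> real) \<Rightarrow> ('p \<Rightarrow> real) \<Rightarrow> ('p \<Rightarrow> real) \<Rightarrow> ('p, 'e) chart \<Rightarrow> 'p \<Rightarrow> bool" where
  "soliton_equation u \<alpha> \<beta> c p \<longleftrightarrow> (let G = local_form A g c; U = u \<circ> cinv c; x = cmap c p in
     \<forall>a b. local_hess G U x a b + (\<alpha> p - scalar_curvature G x) * G x a b + \<beta> p * (D U x a * D U x b) = 0)"

lemma soliton_iff:
  assumes u: "smooth_fun A u"
  shows "gradient_almost_quasi_Yamabe_soliton A g (grad A g u) \<alpha> \<beta> \<longleftrightarrow>
    smooth_fun A \<alpha> \<and> smooth_fun A \<beta> \<and> (\<forall>c\<in>A. \<forall>p\<in>cdom c. soliton_equation u \<alpha> \<beta> c p)"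
proof -
  have chart: "(\<forall>v\<in>tangent_space A p. \<forall>w\<in>tangent_space A p.
           hess A g u' p v w + (\<alpha> p - scal A g p) * g p v w
           + \<beta> p * (differential u' v * differential u' w) = 0) \<longleftrightarrow> soliton_equation u' \<alpha> \<beta> c p"
    if "smooth_fun A u'" "c \<in> A" "p \<in> cdom c" for u' c p
    unfolding tangent_space_eq[OF that(2,3)] soliton_equation_def Let_def
    by (simp add: hess_chart that g_coord_vec scal_chart[OF that(2,3)] differential_coord_vec)
  have eq: "(\<forall>p. \<forall>v\<in>tangent_space A p. \<forall>w\<in>tangent_space A p.
           hess A g u' p v w + (\<alpha> p - scal A g p) * g p v w
           + \<beta> p * (differential u' v * differential u' w) = 0) \<longleftrightarrow> 
     (\<forall>c\<in>A. \<forall>p\<in>cdom c. soliton_equation u' \<alpha> \<beta> c p)"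
    if "smooth_fun A u'" for u'
    using chart[OF that] chart_at by metis
  have "soliton_equation u \<alpha> \<beta> c p" if "smooth_fun A u'" "grad A g u = grad A g u'" "c \<in> A" "p \<in> cdom c"
    "soliton_equation u' \<alpha> \<beta> c p" for u' c p
    using that(5) same_grad_same_hess[OF u that(1-3) cmap_in[OF that(3,4)]]
    unfolding soliton_equation_def Let_def by simp
  then show ?thesis
    unfolding gradient_almost_quasi_Yamabe_soliton_def using eq u riemannian_manifold by metis
qed

end

section \<open>Product manifolds\<close>

definition prod_chart :: "('p, 'e) chart \<Rightarrow> ('q, 'f) chart \<Rightarrow> ('p \<times> 'q, 'e \<times> 'f) chart" where
  "prod_chart c d = Chart (cdom c \<times> cdom d) (map_prod (cmap c) (cmap d))"

lemma prod_chart_sel [simp]: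
  "cdom (prod_chart c d) = cdom c \<times> cdom d" "cmap (prod_chart c d) = map_prod (cmap c) (cmap d)"
  by (simp_all add: prod_chart_def)

lemma cimg_prod_chart [simp]: "cimg (prod_chart c d) = cimg c \<times> cimg d"
  unfolding cimg_def by (simp add: map_prod_surj_on)

lemma prod_atlas_cases:
  assumes "e \<in> prod_atlas A B" obtains c d where "c \<in> A" "d \<in> B" "e = prod_chart c d"
  using assms unfolding prod_atlas_def prod_chart_def by blast

lemma prod_chart_in: "c \<in> A \<Longrightarrow> d \<in> B \<Longrightarrow> prod_chart c d \<in> prod_atlas A B"
  unfolding prod_atlas_def prod_chart_def by blast

lemma continuous_on_map_prod:
  assumes "continuous_on S f" "continuous_on T g"
  shows "continuous_on (S \<times> T) (\<lambda>z. (f (fst z), g (snd z)))"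
proof (rule continuous_on_Pair)
  show "continuous_on (S \<times> T) (\<lambda>z. f (fst z))"
    by (rule continuous_on_compose2[OF assms(1) continuous_on_fst[OF continuous_on_id]]) auto
  show "continuous_on (S \<times> T) (\<lambda>z. g (snd z))"
    by (rule continuous_on_compose2[OF assms(2) continuous_on_snd[OF continuous_on_id]]) auto
qed

locale atlas_pair = A: smooth_atlas A + B: smooth_atlas B
  for A :: "('p::{t2_space, second_countable_topology}, 'e::euclidean_space) chart set"
    and B :: "('q::{t2_space, second_countable_topology}, 'f::euclidean_space) chart set"
begin

lemma cinv_prod_chart:
  assumes "c \<in> A" "d \<in> B" "x \<in> cimg c" "y \<in> cimg d"
  shows "cinv (prod_chart c d) (x, y) = (cinv c x, cinv d y)"
proof -
  have "inj_on (cmap c) (cdom c)" "inj_on (cmap d) (cdom d)"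
    using inj_on_inverseI[of "cdom c" "cinv c" "cmap c"] inj_on_inverseI[of "cdom d" "cinv d" "cmap d"]
      A.cinv_cmap[OF assms(1)] B.cinv_cmap[OF assms(2)] by simp_all
  then have "inj_on (map_prod (cmap c) (cmap d)) (cdom c \<times> cdom d)" by (rule map_prod_inj_on)
  then show ?thesis
    unfolding cinv_def[of "prod_chart c d"] prod_chart_sel
    by (rule inv_into_f_eq)
       (simp_all add: A.cinv_in[OF assms(1,3)] A.cmap_cinv[OF assms(1,3)] B.cinv_in[OF assms(2,4)] B.cmap_cinv[OF assms(2,4)])
qed

lemma smooth_manifold_prod: "smooth_manifold (prod_atlas A B)"
  unfolding smooth_manifold_def
proof (intro conjI ballI)
  fix e assume "e \<in> prod_atlas A B"
  then obtain c d where c: "c \<in> A" and d: "d \<in> B" and e: "e = prod_chart c d" by (rule prod_atlas_cases)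
  show "open (cdom e)" "open (cimg e)"
    using c d by (simp_all add: e open_Times A.open_cdom B.open_cdom)
  have cont: "continuous_on (cdom c) (cmap c)" "continuous_on (cimg c) (cinv c)"
    "continuous_on (cdom d) (cmap d)" "continuous_on (cimg d) (cinv d)"
    using A.chart_homeomorphism[OF c] B.chart_homeomorphism[OF d] by (simp_all add: homeomorphism_def)
  have 1: "continuous_on (cimg e) (cinv e)"
    unfolding e cimg_prod_chart
    by (rule continuous_on_eq[OF continuous_on_map_prod[OF cont(2,4)]]) (auto simp: cinv_prod_chart c d)
  have 2: "continuous_on (cdom e) (cmap e)"
    unfolding e prod_chart_sel
    by (rule continuous_on_eq[OF continuous_on_map_prod[OF cont(1,3)]]) auto
  show "homeomorphism (cdom e) (cimg e) (cmap e) (cinv e)"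
  proof (rule homeomorphismI[OF 2 1])
    show "cmap e ` cdom e \<subseteq> cimg e" by (simp add: cimg_def)
    show "cinv e ` cimg e \<subseteq> cdom e" by (auto simp: e cinv_prod_chart c d A.cinv_in B.cinv_in)
    show "cinv e (cmap e z) = z" if "z \<in> cdom e" for z
      using that by (auto simp: e cinv_prod_chart c d A.cmap_in B.cmap_in A.cinv_cmap B.cinv_cmap)
    show "cmap e (cinv e z) = z" if "z \<in> cimg e" for z
      using that by (auto simp: e cinv_prod_chart c d A.cmap_cinv B.cmap_cinv)
  qed
next
  show "(\<Union>e\<in>prod_atlas A B. cdom e) = UNIV"
  proof (intro set_eqI iffI UNIV_I)
    fix z :: "'p \<times> 'q"
    have "z \<in> cdom (prod_chart (chart_at A (fst z)) (chart_at B (snd z)))"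
      by (simp add: mem_Times_iff A.chart_at B.chart_at)
    then show "z \<in> (\<Union>e\<in>prod_atlas A B. cdom e)"
      using prod_chart_in[OF A.chart_at(1) B.chart_at(1)] by blast
  qed
next
  fix e e' assume "e \<in> prod_atlas A B" "e' \<in> prod_atlas A B"
  then obtain c d c' d' where cd: "c \<in> A" "d \<in> B" "e = prod_chart c d" "c' \<in> A" "d' \<in> B" "e' = prod_chart c' d'"
    by (metis prod_atlas_cases)
  have dom: "cmap e ` (cdom e \<inter> cdom e') = A.overlap c c' \<times> B.overlap d d'"
    by (simp add: cd Times_Int_Times map_prod_surj_on)
  note opA = A.open_overlap[OF cd(1,4)] and opB = B.open_overlap[OF cd(2,5)]
  have "smooth_on (A.overlap c c' \<times> B.overlap d d') (\<lambda>z. (A.transition c c' (fst z), B.transition d d' (snd z)))"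
    by (intro smooth_on_Pair smooth_on_comp_fst smooth_on_comp_snd A.transition_smooth B.transition_smooth open_Times opA opB cd)
  moreover have "(cmap e' \<circ> cinv e) z = (A.transition c c' (fst z), B.transition d d' (snd z))"
    if "z \<in> A.overlap c c' \<times> B.overlap d d'" for z
    using that A.overlap_subset[OF cd(1), of c'] B.overlap_subset[OF cd(2), of d']
    by (cases z) (auto simp: cd(3,6) cinv_prod_chart cd(1,2) subset_iff)
  ultimately show "smooth_on (cmap e ` (cdom e \<inter> cdom e')) (cmap e' \<circ> cinv e)"
    unfolding dom using smooth_on_cong[OF open_Times[OF opA opB], of "cmap e' \<circ> cinv e"] by simp
qed

sublocale P: smooth_atlas "prod_atlas A B"
  by unfold_locales (rule smooth_manifold_prod)

lemma smooth_near_comp_fst: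
  assumes "smooth_near A p h" shows "smooth_near (prod_atlas A B) (p, q) (h \<circ> fst)"
proof -
  obtain U where U: "open U" "p \<in> U" "smooth_fun_on A U h" using assms unfolding smooth_near_def by blast
  have "smooth_fun_on (prod_atlas A B) (U \<times> UNIV) (h \<circ> fst)"
    unfolding smooth_fun_on_def
  proof
    fix e assume "e \<in> prod_atlas A B"
    then obtain c d where c: "c \<in> A" and d: "d \<in> B" and e: "e = prod_chart c d" by (rule prod_atlas_cases)
    have dom: "cmap e ` (cdom e \<inter> U \<times> UNIV) = cmap c ` (cdom c \<inter> U) \<times> cimg d"
      by (simp add: e Times_Int_Times map_prod_surj_on cimg_def)
    have "smooth_on (cmap c ` (cdom c \<inter> U) \<times> cimg d) (\<lambda>z. (h \<circ> cinv c) (fst z))"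
      using U c d by (intro smooth_on_comp_fst A.open_chart_image B.open_cimg) (auto simp: smooth_fun_on_def comp_def)
    moreover have "(h \<circ> fst \<circ> cinv e) z = (h \<circ> cinv c) (fst z)" if "z \<in> cmap c ` (cdom c \<inter> U) \<times> cimg d" for z
      using that c d by (cases z) (auto simp: e cinv_prod_chart A.cmap_in)
    ultimately show "smooth_on (cmap e ` (cdom e \<inter> U \<times> UNIV)) (h \<circ> fst \<circ> cinv e)"
      unfolding dom
      using smooth_on_cong[OF open_Times[OF A.open_chart_image[OF c U(1)] B.open_cimg[OF d]], of "h \<circ> fst \<circ> cinv e"] by simp
  qed
  then show ?thesis
    unfolding smooth_near_def using U by (intro exI[of _ "U \<times> UNIV"]) (auto intro: open_Times)
qed

lemma smooth_near_comp_snd: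
  assumes "smooth_near B q h" shows "smooth_near (prod_atlas A B) (p, q) (h \<circ> snd)"
proof -
  obtain U where U: "open U" "q \<in> U" "smooth_fun_on B U h" using assms unfolding smooth_near_def by blast
  have "smooth_fun_on (prod_atlas A B) (UNIV \<times> U) (h \<circ> snd)"
    unfolding smooth_fun_on_def
  proof
    fix e assume "e \<in> prod_atlas A B"
    then obtain c d where c: "c \<in> A" and d: "d \<in> B" and e: "e = prod_chart c d" by (rule prod_atlas_cases)
    have dom: "cmap e ` (cdom e \<inter> UNIV \<times> U) = cimg c \<times> cmap d ` (cdom d \<inter> U)"
      by (simp add: e Times_Int_Times map_prod_surj_on cimg_def)
    have "smooth_on (cimg c \<times> cmap d ` (cdom d \<inter> U)) (\<lambda>z. (h \<circ> cinv d) (snd z))"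
      using U c d by (intro smooth_on_comp_snd B.open_chart_image A.open_cimg) (auto simp: smooth_fun_on_def comp_def)
    moreover have "(h \<circ> snd \<circ> cinv e) z = (h \<circ> cinv d) (snd z)" if "z \<in> cimg c \<times> cmap d ` (cdom d \<inter> U)" for z
      using that c d by (cases z) (auto simp: e cinv_prod_chart B.cmap_in)
    ultimately show "smooth_on (cmap e ` (cdom e \<inter> UNIV \<times> U)) (h \<circ> snd \<circ> cinv e)"
      unfolding dom
      using smooth_on_cong[OF open_Times[OF A.open_cimg[OF c] B.open_chart_image[OF d U(1)]], of "h \<circ> snd \<circ> cinv e"] by simp
  qed
  then show ?thesis
    unfolding smooth_near_def using U by (intro exI[of _ "UNIV \<times> U"]) (auto intro: open_Times)
qed

lemma smooth_fun_comp_fst: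
  assumes "smooth_fun A h" shows "smooth_fun (prod_atlas A B) (h \<circ> fst)"
  unfolding P.smooth_fun_iff
proof
  fix e assume "e \<in> prod_atlas A B"
  then obtain c d where c: "c \<in> A" and d: "d \<in> B" and e: "e = prod_chart c d" by (rule prod_atlas_cases)
  have "smooth_on (cimg c \<times> cimg d) (\<lambda>z. (h \<circ> cinv c) (fst z))"
    using assms c d by (intro smooth_on_comp_fst A.open_cimg B.open_cimg) (auto simp: A.smooth_fun_iff comp_def)
  moreover have "(h \<circ> fst \<circ> cinv e) z = (h \<circ> cinv c) (fst z)" if "z \<in> cimg c \<times> cimg d" for z
    using that c d by (cases z) (auto simp: e cinv_prod_chart)
  ultimately show "smooth_on (cimg e) (h \<circ> fst \<circ> cinv e)"
    unfolding e cimg_prod_chart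
    using smooth_on_cong[OF open_Times[OF A.open_cimg[OF c] B.open_cimg[OF d]], of "h \<circ> fst \<circ> cinv e"] e by simp
qed

lemma push_forward_fst:
  assumes c: "c \<in> A" "p \<in> cdom c" and d: "d \<in> B" "q \<in> cdom d"
  shows "push_forward A fst (p, q) (coord_vec (prod_atlas A B) (prod_chart c d) (p, q) v) = coord_vec A c p (fst v)"
proof
  fix h
  have "D (h \<circ> fst \<circ> cinv (prod_chart c d)) (cmap c p, cmap d q) v = D (h \<circ> cinv c) (cmap c p) (fst v)"
    if h: "smooth_near A p h"
  proof -
    have "((h \<circ> fst \<circ> cinv (prod_chart c d)) has_derivative (\<lambda>v. D (h \<circ> cinv c) (cmap c p) (fst v))) (at (cmap c p, cmap d q))"
      by (rule has_derivative_transform_within_open[OF has_derivative_comp_fst[OF A.smooth_near_has_derivative[OF h c]]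
            open_Times[OF A.open_cimg[OF c(1)] B.open_cimg[OF d(1)]]])
         (auto simp: c d A.cmap_in B.cmap_in cinv_prod_chart)
    from D_eqI[OF this] show ?thesis by simp
  qed
  then show "push_forward A fst (p, q) (coord_vec (prod_atlas A B) (prod_chart c d) (p, q) v) h = coord_vec A c p (fst v) h"
    by (simp add: push_forward_def coord_vec_def smooth_near_comp_fst)
qed

lemma push_forward_snd:
  assumes c: "c \<in> A" "p \<in> cdom c" and d: "d \<in> B" "q \<in> cdom d"
  shows "push_forward B snd (p, q) (coord_vec (prod_atlas A B) (prod_chart c d) (p, q) v) = coord_vec B d q (snd v)"
proof
  fix h
  have "D (h \<circ> snd \<circ> cinv (prod_chart c d)) (cmap c p, cmap d q) v = D (h \<circ> cinv d) (cmap d q) (snd v)"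
    if h: "smooth_near B q h"
  proof -
    have "((h \<circ> snd \<circ> cinv (prod_chart c d)) has_derivative (\<lambda>v. D (h \<circ> cinv d) (cmap d q) (snd v))) (at (cmap c p, cmap d q))"
      by (rule has_derivative_transform_within_open[OF has_derivative_comp_snd[OF B.smooth_near_has_derivative[OF h d]]
            open_Times[OF A.open_cimg[OF c(1)] B.open_cimg[OF d(1)]]])
         (auto simp: c d A.cmap_in B.cmap_in cinv_prod_chart)
    from D_eqI[OF this] show ?thesis by simp
  qed
  then show "push_forward B snd (p, q) (coord_vec (prod_atlas A B) (prod_chart c d) (p, q) v) h = coord_vec B d q (snd v) h"
    by (simp add: push_forward_def coord_vec_def smooth_near_comp_snd)
qed

end

section \<open>Solitons on warped products\<close>

locale warped_product = B: riemannian AB gB + F: riemannian AF gF + atlas_pair AB AF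
  for AB :: "('p::{t2_space, second_countable_topology}, 'e::euclidean_space) chart set" and gB
    and AF :: "('q::{t2_space, second_countable_topology}, 'f::euclidean_space) chart set" and gF +
  fixes \<phi> :: "'p \<Rightarrow> real"
  assumes warp_smooth: "smooth_fun AB \<phi>" and warp_pos: "\<phi> p > 0"
begin

abbreviation "A \<equiv> prod_atlas AB AF"
abbreviation "g \<equiv> warped_metric AB AF \<phi> gB gF"

lemma local_warped_product:
  assumes "c \<in> AB" "d \<in> AF"
  shows "local_warped_product (cimg c) (local_form AB gB c) (cimg d) (local_form AF gF d) (\<phi> \<circ> cinv c)"
  unfolding local_warped_product_def local_warped_product_axioms_def
  using B.metric_on F.metric_on B.smooth_on_chart[OF warp_smooth] warp_pos assms by simp

abbreviation "local_warped_form c d \<equiv> warped_form (local_form AB gB c) (\<phi> \<circ> cinv c) (local_form AF gF d)"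

lemma local_form_warped:
  assumes "c \<in> AB" "d \<in> AF" "z \<in> cimg c \<times> cimg d"
  shows "local_form A g (prod_chart c d) z v w = local_warped_form c d z v w"
proof -
  obtain x y where xy: "z = (x, y)" "x \<in> cimg c" "y \<in> cimg d" using assms(3) by auto
  show ?thesis
    unfolding xy(1) local_form_def[of A] cinv_prod_chart[OF assms(1,2) xy(2,3)] warped_metric_def pull_back_def
      push_forward_fst[OF assms(1) B.cinv_in[OF assms(1) xy(2)] assms(2) F.cinv_in[OF assms(2) xy(3)]]
      push_forward_snd[OF assms(1) B.cinv_in[OF assms(1) xy(2)] assms(2) F.cinv_in[OF assms(2) xy(3)]]
    by (simp add: warped_form_def local_form_def)
qed

lemma riemannian_warped: "riemannian A g"
proof
  show "riemannian_metric A g"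
    unfolding P.riemannian_metric_iff
  proof
    fix e assume "e \<in> A"
    then obtain c d where c: "c \<in> AB" and d: "d \<in> AF" and e: "e = prod_chart c d" by (rule prod_atlas_cases)
    interpret local_warped_product "cimg c" "local_form AB gB c" "cimg d" "local_form AF gF d" "\<phi> \<circ> cinv c"
      by (rule local_warped_product[OF c d])
    show "metric_on (cimg e) (local_form A g e)"
      unfolding e cimg_prod_chart
      by (rule metric_on_cong(1)[OF metric_on_axioms local_form_warped[OF c d]])
  qed
qed

sublocale W: riemannian A g by (rule riemannian_warped)

text \<open>
  The hypothesis on \<open>scal AF gF q\<close> cancels all that the warped product adds to the scalar curvature of the base
  except for \<open>lam p - lamB p\<close>, so the coefficient of the metric in the soliton equation is
  \<open>lamB p - scal AB gB p\<close> on the warped product as well as on the base. By the choice of \<open>lamB\<close> it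
  equals \<open>- \<langle>grad f, grad \<phi>\<rangle> / \<phi>\<close>, which makes the vertical part of the metric term opposite to
  the vertical part of the Hessian. What is left is the equation on the base, evaluated at horizontal
  components.
\<close>

lemma soliton_equation_warped:
  assumes f: "smooth_fun AB f" and c: "c \<in> AB" "p \<in> cdom c" and d: "d \<in> AF" "q \<in> cdom d"
    and scal: "scal AF gF q = (lam p - lamB p) * (\<phi> p)\<^sup>2 + 2 * real DIM('f) * \<phi> p * laplacian AB gB \<phi> p
                  + real DIM('f) * (real DIM('f) - 1) * (gnorm gB p (grad AB gB \<phi> p))\<^sup>2"
    and lamB: "lamB p = scal AB gB p - differential \<phi> (grad AB gB f p) / \<phi> p"
  shows "W.soliton_equation (f \<circ> fst) (lam \<circ> fst) (\<mu> \<circ> fst) (prod_chart c d) (p, q)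
    \<longleftrightarrow> B.soliton_equation f lamB \<mu> c p"
proof -
  interpret L: local_warped_product "cimg c" "local_form AB gB c" "cimg d" "local_form AF gF d" "\<phi> \<circ> cinv c"
    by (rule local_warped_product[OF c(1) d(1)])
  let ?x = "cmap c p" and ?y = "cmap d q" and ?U = "f \<circ> cinv c" and ?\<Phi> = "\<phi> \<circ> cinv c"
  let ?GB = "local_form AB gB c" and ?GF = "local_form AF gF d" and ?e = "prod_chart c d"
  let ?G = "local_form A g ?e"
  have x: "?x \<in> cimg c" and y: "?y \<in> cimg d" using c d B.cmap_in F.cmap_in by auto
  have z: "(?x, ?y) \<in> cimg c \<times> cimg d" using x y by simp
  have U: "smooth_on (cimg c) ?U" and \<Phi>: "smooth_on (cimg c) ?\<Phi>"
    using B.smooth_on_chart f warp_smooth c by auto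
  have \<Phi>x: "?\<Phi> ?x = \<phi> p" by (simp add: B.cinv_cmap c)
  interpret I: local_isometry "cimg c \<times> cimg d" ?G "cimg c \<times> cimg d" "local_warped_form c d" "\<lambda>z. z"
    by (rule metric_on_cong(2)[OF L.metric_on_axioms local_form_warped[OF c(1) d(1)]])
  have pull: "(f \<circ> fst \<circ> cinv ?e) z = ?U (fst z)" if "z \<in> cimg c \<times> cimg d" for z
    using that by (cases z) (simp add: cinv_prod_chart c d)
  have U': "smooth_on (cimg c \<times> cimg d) (\<lambda>z. ?U (fst z))"
    by (rule smooth_on_comp_fst[OF U L.B.open_S L.F.open_S])
  have deriv: "D (f \<circ> fst \<circ> cinv ?e) (?x, ?y) v = D ?U ?x (fst v)" for v
  proof -
    have "D (f \<circ> fst \<circ> cinv ?e) (?x, ?y) v = D (\<lambda>z. ?U (fst z)) (?x, ?y) (D (\<lambda>z. z) (?x, ?y) v)"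
      by (rule I.deriv_transform[OF U' pull z])
    also have "D (\<lambda>z. ?U (fst z)) (?x, ?y) = (\<lambda>v. D ?U ?x (fst v))"
      by (rule D_eqI[OF has_derivative_comp_fst[OF smooth_on_has_derivative[OF U x]]])
    finally show ?thesis by (simp only: frechet_derivative_ident)
  qed
  have hess: "local_hess ?G (f \<circ> fst \<circ> cinv ?e) (?x, ?y) v w =
     local_hess ?GB ?U ?x (fst v) (fst w) + \<phi> p * ?GF ?y (snd v) (snd w) * D ?U ?x (local_grad ?GB ?\<Phi> ?x)" for v w
  proof -
    have "local_hess ?G (f \<circ> fst \<circ> cinv ?e) (?x, ?y) v w = local_hess L.G (\<lambda>z. ?U (fst z)) (?x, ?y)
        (D (\<lambda>z. z) (?x, ?y) v) (D (\<lambda>z. z) (?x, ?y) w)"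
      by (rule I.local_hess_transform[OF U' pull z])
    then show ?thesis by (simp only: frechet_derivative_ident L.local_hess_warped[OF x y U] \<Phi>x)
  qed
  have "scalar_curvature ?G (?x, ?y) = scal AB gB p + (scal AF gF q
      - 2 * real DIM('f) * \<phi> p * laplacian AB gB \<phi> p
      - real DIM('f) * (real DIM('f) - 1) * (gnorm gB p (grad AB gB \<phi> p))\<^sup>2) / (\<phi> p)\<^sup>2"
    using I.scalar_curvature_transform[OF z] L.scalar_curvature_warped[OF x y]
    by (simp add: B.scal_chart[OF c] F.scal_chart[OF d] B.laplacian_chart[OF warp_smooth c] B.gnorm_grad_chart[OF warp_smooth c] \<Phi>x[simplified])
  then have scal_W: "scalar_curvature ?G (?x, ?y) = scal AB gB p + lam p - lamB p"
    using warp_pos[of p] by (simp add: scal)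
  have G: "?G (?x, ?y) v w = ?GB ?x (fst v) (fst w) + (\<phi> p)\<^sup>2 * ?GF ?y (snd v) (snd w)" for v w
    using local_form_warped[OF c(1) d(1) z] \<Phi>x by (simp add: warped_form_def)
  \<comment> \<open>both sides are the inner product of the two gradients\<close>
  have "D ?U ?x (local_grad ?GB ?\<Phi> ?x) = D ?\<Phi> ?x (local_grad ?GB ?U ?x)"
    using L.B.G_local_grad[OF U x] L.B.G_local_grad[OF \<Phi> x] L.B.sym[OF x] by metis
  then have cross: "D ?U ?x (local_grad ?GB ?\<Phi> ?x) = (scal AB gB p - lamB p) * \<phi> p"
    using warp_pos[of p] by (simp add: lamB B.grad_chart[OF f c] B.differential_coord_vec[OF warp_smooth])
  have eq: "local_hess ?G (f \<circ> fst \<circ> cinv ?e) (?x, ?y) v w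
      + (lam p - scalar_curvature ?G (?x, ?y)) * ?G (?x, ?y) v w
      + \<mu> p * (D (f \<circ> fst \<circ> cinv ?e) (?x, ?y) v * D (f \<circ> fst \<circ> cinv ?e) (?x, ?y) w)
    = local_hess ?GB ?U ?x (fst v) (fst w) + (lamB p - scalar_curvature ?GB ?x) * ?GB ?x (fst v) (fst w)
      + \<mu> p * (D ?U ?x (fst v) * D ?U ?x (fst w))" for v w
    unfolding hess deriv scal_W G cross B.scal_chart[OF c, symmetric]
    by (simp add: algebra_simps power2_eq_square)
  show ?thesis
    unfolding W.soliton_equation_def B.soliton_equation_def Let_def
    using eq by (auto simp: comp_def)
qed

end

theorem theorem3p2:
  fixes AB :: "('b::{t2_space, second_countable_topology}, 'n::euclidean_space) chart set"
    and AF :: "('f::{t2_space, second_countable_topology}, 'm::euclidean_space) chart set"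
    and gB :: "'b bform" and gF :: "'f bform" and g :: "('b \<times> 'f) bform"
    and \<phi> f \<mu> lam lamB :: "'b \<Rightarrow> real"
    and \<xi> :: "'b \<times> 'f \<Rightarrow> ('b \<times> 'f) tvec"
    and n m :: nat
  assumes B: "riemannian_manifold AB gB" and n: "n = DIM('n)"
    and F: "riemannian_manifold AF gF" and m: "m = DIM('m)"
    and \<phi>: "smooth_fun AB \<phi>" "\<And>p. \<phi> p > 0"
    and f: "smooth_fun AB f" and \<mu>: "smooth_fun AB \<mu>" and lam: "smooth_fun AB lam"
    and pde: "\<And>p. laplacian AB gB f p + \<mu> p * (gnorm gB p (grad AB gB f p))\<^sup>2
                = real n * (differential \<phi> (grad AB gB f p) / \<phi> p)"
    and lamB: "lamB = (\<lambda>p. scal AB gB p - differential \<phi> (grad AB gB f p) / \<phi> p)"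
    and scalF: "\<And>p q. scal AF gF q =
                  (lam p - lamB p) * (\<phi> p)\<^sup>2 + 2 * real m * \<phi> p * laplacian AB gB \<phi> p
                  + real m * (real m - 1) * (gnorm gB p (grad AB gB \<phi> p))\<^sup>2"
    and g: "g = warped_metric AB AF \<phi> gB gF"
    and \<xi>: "\<xi> = grad (prod_atlas AB AF) g (f \<circ> fst)"
  shows "gradient_almost_quasi_Yamabe_soliton (prod_atlas AB AF) g \<xi> (lam \<circ> fst) (\<mu> \<circ> fst)
     \<longleftrightarrow> gradient_almost_quasi_Yamabe_soliton AB gB (grad AB gB f) lamB \<mu>"
proof -
  interpret warped_product AB gB AF gF \<phi>
    using B F \<phi> by unfold_locales (auto simp: riemannian_manifold_def)
  \<comment> \<open>The hypothesis on the scalar curvature of the fibre, at one fixed point of the fibre, can be solved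
     for \<open>lamB\<close> in terms of functions whose smoothness is known.\<close>
  have lamB_smooth: "smooth_fun AB lamB"
    unfolding B.smooth_fun_iff
  proof
    fix c assume c: "c \<in> AB"
    fix q0 :: 'f
    define L where "L = (\<lambda>p. lam p - (scal AF gF q0 - 2 * real m * \<phi> p * laplacian AB gB \<phi> p
                  - real m * (real m - 1) * (gnorm gB p (grad AB gB \<phi> p))\<^sup>2) / (\<phi> p * \<phi> p))"
    have "lamB p = L p" for p
      using \<phi>(2)[of p] by (simp add: L_def scalF[of q0 p] power2_eq_square)
    then have "lamB = L" by blast
    have "smooth_on (cimg c) (\<lambda>x. lam (cinv c x) - (scal AF gF q0 - 2 * real m * \<phi> (cinv c x) * laplacian AB gB \<phi> (cinv c x)
                  - real m * (real m - 1) * (gnorm gB (cinv c x) (grad AB gB \<phi> (cinv c x)))\<^sup>2) / (\<phi> (cinv c x) * \<phi> (cinv c x)))"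
      using B.smooth_on_chart[OF lam c] B.smooth_on_chart[OF \<phi>(1) c] B.smooth_on_chart[OF B.laplacian_smooth[OF \<phi>(1)] c]
        B.smooth_on_chart[OF B.gnorm_grad_smooth[OF \<phi>(1)] c] \<phi>(2)
      by (intro smooth_on_diff smooth_on_divide smooth_on_mult smooth_on_const B.open_cimg[OF c])
         (auto simp: comp_def less_imp_neq[symmetric])
    then show "smooth_on (cimg c) (lamB \<circ> cinv c)"
      unfolding \<open>lamB = L\<close> L_def comp_def .
  qed
  have "W.soliton_equation (f \<circ> fst) (lam \<circ> fst) (\<mu> \<circ> fst) (prod_chart c d) (p, q)
      \<longleftrightarrow> B.soliton_equation f lamB \<mu> c p"
    if "c \<in> AB" "p \<in> cdom c" "d \<in> AF" "q \<in> cdom d" for c d p q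
    using scalF[of q p] fun_cong[OF lamB, of p] unfolding m by (rule soliton_equation_warped[OF f that])
  then have "(\<forall>e\<in>prod_atlas AB AF. \<forall>z\<in>cdom e. W.soliton_equation (f \<circ> fst) (lam \<circ> fst) (\<mu> \<circ> fst) e z) \<longleftrightarrow>
      (\<forall>c\<in>AB. \<forall>p\<in>cdom c. B.soliton_equation f lamB \<mu> c p)"
    using F.chart_at by (fastforce elim!: prod_atlas_cases intro: prod_chart_in)
  then show ?thesis
    unfolding g \<xi> W.soliton_iff[OF smooth_fun_comp_fst[OF f]] B.soliton_iff[OF f]
    using lamB_smooth \<mu> smooth_fun_comp_fst[OF lam] smooth_fun_comp_fst[OF \<mu>] by simp
qed

end
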